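(* Let $(X(t)\colon t\in[0,+\infty))$ be an $\mathcal{A}$-valued martingale continuous in Segal's sense. Let $t\geqslant0$, and for a partition $\theta=\{0=t_0<t_1<\dots<t_m=t\}$ of $[0,t]$ put \[ S_{\theta}(t)=\sum_{k=1}^m|X(t_k)-X(t_{k-1})|^2. \] Then $\{S_\theta(t)\}$ converges in $\|\cdot\|_2$-norm, as $\|\theta\|\to0$, to \[ \langle X\rangle(t):=|X(t)|^2-|X(0)|^2-\left(\int_0^t dX^*(u)\,X(u)+\int_0^t X^*(u)\,dX(u)\right). \]
   Context: Setting: $\mathcal{A}$ is a von Neumann algebra acting on a Hilbert space $\mathcal{H}$ with a normal faithful unital trace $\tau$ ($\tau(\mathbf 1)=1$); $(\mathcal{A}_t\colon t\in[0,+\infty))$ is an increasing family of von Neumann subalgebras of $\mathcal{A}$ with $\mathcal{A}=(\bigcup_{t\geqslant0}\mathcal{A}_t)''$ and $\mathcal{A}_s=\bigcap_{t>s}\mathcal{A}_t$; for each $t$, $\mathbb{E}_t$ is the normal conditional expectation from $\mathcal{A}$ onto $\mathcal{A}_t$ with $\tau\circ\mathbb{E}_t=\tau$. $L^2(\mathcal{A})$ is the noncommutative $L^2$-space of $(\mathcal{A},\tau)$ with norm $\|X\|_2=[\tau(|X|^2)]^{1/2}$, $|X|^2=X^*X$; $\|\cdot\|_\infty$ is the operator norm of $\mathcal{A}$. An $\mathcal{A}$-valued martingale is a map $t\mapsto X(t)\in\mathcal{A}$ on $[0,+\infty)$ with $\mathbb{E}_sX(t)=X(s)$ for all $s\leqslant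 t$. $X^*(t)$ denotes $X(t)^*$. The mesh of $\theta$ is $\|\theta\|=\max_k(t_k-t_{k-1})$. Segal continuity: a process $(X(t))$ is continuous in Segal's sense if on each interval $[a,b]\subset[0,+\infty)$ it satisfies both of the following conditions (R) and (L). (R): for each $\varepsilon>0$ there is a projection $e\in\mathcal{A}$ with $\tau(e)>1-\varepsilon$ such that for each $\eta>0$ there is $\delta>0$ such that for all $s,t\in[a,b]$ with $|t-s|<\delta$ we have $[X(t)-X(s)]e\in\mathcal{A}$ and $\|[X(t)-X(s)]e\|_\infty\leqslant\eta$. (L): the same with $[X(t)-X(s)]e$ replaced by $e[X(t)-X(s)]$. Stochastic integrals: for processes $X,Y$ and a partition $\theta$ of $[0,t]$, the left integral $\int_0^t dX(u)\,Y(u)$ is the limit in $\|\cdot\|_2$-norm, as $\|\theta\|\to0$, of $\sum_{k=1}^m[X(t_k)-X(t_{k-1})]Y(t_{k-1})$, and the right integral $\int_0^t Y(u)\,dX(u)$ is the limit in $\|\cdot\|_2$-norm, as $\|\theta\|\to0$, of $\sum_{k=1}^m Y(t_{k-1})[X(t_k)-X(t_{k-1})]$; for $t=0$ the integrals are $0$. The integrals appearing in the claim exist in $L^2(\mathcal{A})$ for $X$ as in the claim. *)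

theory Defs
  imports "HOL-Analysis.Analysis"
begin

section \<open>Complex Hilbert spaces and bounded operators\<close>

text \<open>The inner product is linear in the first argument.\<close>

class complex_hilbert_space = banach +
  fixes scaleC :: "complex \<Rightarrow> 'a \<Rightarrow> 'a"  (infixr \<open>*\<^sub>C\<close> 75)
    and cinner :: "'a \<Rightarrow> 'a \<Rightarrow> complex"
  assumes scaleC_add_right: "c *\<^sub>C (x + y) = c *\<^sub>C x + c *\<^sub>C y"
    and scaleC_add_left: "(c + d) *\<^sub>C x = c *\<^sub>C x + d *\<^sub>C x"
    and scaleC_scaleC: "c *\<^sub>C d *\<^sub>C x = (c * d) *\<^sub>C x"
    and scaleR_scaleC: "r *\<^sub>R x = complex_of_real r *\<^sub>C x"
    and cinner_commute: "cinner x y = cnj (cinner y x)"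
    and cinner_add_left: "cinner (x + y) z = cinner x z + cinner y z"
    and cinner_scaleC_left: "cinner (c *\<^sub>C x) y = c * cinner x y"
    and norm_eq_sqrt_cinner: "norm x = sqrt (Re (cinner x x))"

lemma cinner_add_right: "cinner x (y + z) = cinner x y + cinner x z"
  by (metis cinner_add_left cinner_commute complex_cnj_add)

lemma cinner_scaleC_right: "cinner x (c *\<^sub>C y) = cnj c * cinner x y"
  by (metis cinner_commute cinner_scaleC_left complex_cnj_mult)

lemma cinner_self: "cinner x x = complex_of_real ((norm x)\<^sup>2)"
proof -
  have "0 \<le> sqrt (Re (cinner x x))"
    by (metis norm_eq_sqrt_cinner norm_ge_zero)
  then have "Re (cinner x x) = (norm x)\<^sup>2"
    by (simp add: norm_eq_sqrt_cinner)
  moreover have "Im (cinner x x) = 0"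
    by (metis cinner_commute cnj.simps(2) equal_neg_zero)
  ultimately show ?thesis
    by (simp add: complex_eq_iff)
qed

lemma norm_scaleC: "norm (c *\<^sub>C x) = cmod c * norm x"
proof -
  have "complex_of_real ((norm (c *\<^sub>C x))\<^sup>2) = (c * cnj c) * cinner x x"
    by (simp only: cinner_self[symmetric] cinner_scaleC_left cinner_scaleC_right mult_ac)
  also have "\<dots> = complex_of_real ((cmod c * norm x)\<^sup>2)"
    by (simp only: cinner_self complex_norm_square[symmetric] of_real_mult power_mult_distrib)
  finally have "complex_of_real ((norm (c *\<^sub>C x))\<^sup>2) = complex_of_real ((cmod c * norm x)\<^sup>2)" .
  then have "(norm (c *\<^sub>C x))\<^sup>2 = (cmod c * norm x)\<^sup>2"
    using of_real_eq_iff by blast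
  then show ?thesis
    by (simp add: power2_eq_iff_nonneg)
qed

lemma cinner_zero_left [simp]: "cinner 0 x = 0"
  by (metis add_cancel_left_left cinner_add_left)

lemma cinner_zero_right [simp]: "cinner x 0 = 0"
  by (metis cinner_commute cinner_zero_left complex_cnj_zero)

lemma cinner_minus_left: "cinner (- x) y = - cinner x y"
  by (metis add.right_inverse add_eq_0_iff cinner_add_left cinner_zero_left)

lemma cinner_diff_left: "cinner (x - y) z = cinner x z - cinner y z"
  using cinner_add_left[of x "- y" z] by (simp add: cinner_minus_left)

lemma cinner_diff_right: "cinner x (y - z) = cinner x y - cinner x z"
  by (metis cinner_commute cinner_diff_left complex_cnj_diff)

lemma norm_add_sq: "(norm (x + y))\<^sup>2 = (norm x)\<^sup>2 + 2 * Re (cinner x y) + (norm y)\<^sup>2"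
  for x y :: "'a::complex_hilbert_space"
proof -
  have "Re (cinner (x + y) (x + y)) = Re (cinner x x) + 2 * Re (cinner x y) + Re (cinner y y)"
    using cinner_commute[of y x] by (simp add: cinner_add_left cinner_add_right)
  then show ?thesis by (simp add: cinner_self)
qed

lemma parallelogram: "(norm (x + y))\<^sup>2 + (norm (x - y))\<^sup>2 = 2 * (norm x)\<^sup>2 + 2 * (norm y)\<^sup>2"
  for x y :: "'a::complex_hilbert_space"
  using norm_add_sq[of x y] norm_add_sq[of x "- y"] cinner_diff_right[of x 0 y] by simp

lemma norm_diff_projection_sq:
  fixes u v :: "'a::complex_hilbert_space"
  assumes "v \<noteq> 0"
  shows "(norm (u + (- (cinner u v / complex_of_real ((norm v)\<^sup>2))) *\<^sub>C v))\<^sup>2 =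
    (norm u)\<^sup>2 - (cmod (cinner u v))\<^sup>2 / (norm v)\<^sup>2"
proof -
  define n where "n = (norm v)\<^sup>2"
  define c where "c = - (cinner u v / complex_of_real n)"
  have n: "n > 0" using assms by (simp add: n_def)
  have "cnj c * cinner u v = complex_of_real (- ((cmod (cinner u v))\<^sup>2 / n))"
    unfolding c_def of_real_minus of_real_divide complex_norm_square by (simp add: mult.commute)
  moreover have "(cmod c)\<^sup>2 * n = (cmod (cinner u v))\<^sup>2 / n"
    using n by (simp add: c_def norm_divide power_divide power2_eq_square)
  ultimately have "(norm (u + c *\<^sub>C v))\<^sup>2 = (norm u)\<^sup>2 - (cmod (cinner u v))\<^sup>2 / n"
    by (simp only: norm_add_sq cinner_scaleC_right norm_scaleC power_mult_distrib n_def[symmetric]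
        Re_complex_of_real)
  then show ?thesis by (simp only: c_def n_def)
qed

lemma cinner_eq_zero_if_minimal:
  fixes u v :: "'a::complex_hilbert_space"
  assumes "\<And>c. norm u \<le> norm (u + c *\<^sub>C v)"
  shows "cinner u v = 0"
proof (cases "v = 0")
  case False
  have "(norm u)\<^sup>2 \<le> (norm u)\<^sup>2 - (cmod (cinner u v))\<^sup>2 / (norm v)\<^sup>2"
    unfolding norm_diff_projection_sq[OF False, symmetric]
    using assms power_mono norm_ge_zero by blast
  then have "(cmod (cinner u v))\<^sup>2 / (norm v)\<^sup>2 \<le> 0" by simp
  with False have "(cmod (cinner u v))\<^sup>2 \<le> 0" by (simp add: divide_le_0_iff)
  then show ?thesis by simp
qed simp

lemma cinner_cauchy_schwarz:
  fixes x y :: "'a::complex_hilbert_space"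
  shows "cmod (cinner x y) \<le> norm x * norm y"
proof (cases "y = 0")
  case False
  have "0 \<le> (norm x)\<^sup>2 - (cmod (cinner x y))\<^sup>2 / (norm y)\<^sup>2"
    unfolding norm_diff_projection_sq[OF False, symmetric] by simp
  then have "(cmod (cinner x y))\<^sup>2 \<le> (norm x * norm y)\<^sup>2"
    using False by (simp add: divide_le_eq power_mult_distrib)
  then show ?thesis by (rule power2_le_imp_le) simp
qed simp

lemma riesz_representation:
  fixes f :: "'a::complex_hilbert_space \<Rightarrow> complex"
  assumes add: "\<And>x y. f (x + y) = f x + f y"
    and scale: "\<And>c x. f (c *\<^sub>C x) = c * f x"
    and bound: "\<And>x. cmod (f x) \<le> K * norm x"
  shows "\<exists>z. \<forall>x. f x = cinner x z"
proof (cases "\<forall>x. f x = 0")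
  case True
  then show ?thesis by (intro exI[of _ 0]) simp
next
  case False
  have lin: "bounded_linear f"
    by (rule bounded_linear_intro[where K = K])
       (use add scale bound in \<open>auto simp: scaleR_scaleC scaleR_conv_of_real mult.commute\<close>)
  obtain w where w: "f w \<noteq> 0" using False by blast
  define C where "C = {x. f x = 1}"
  define d where "d = Inf (norm ` C)"
  have wC: "inverse (f w) *\<^sub>C w \<in> C" using w by (simp add: C_def scale)
  have bdd: "bdd_below (norm ` C)" by (rule bdd_belowI[of _ 0]) auto
  have d_le: "d \<le> norm x" if "x \<in> C" for x
    unfolding d_def using that bdd by (intro cInf_lower) auto
  have d0: "0 \<le> d" unfolding d_def using wC by (intro cInf_greatest) auto
  have "\<exists>x\<in>C. norm x < d + 1 / Suc n" for n
  proof -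
    have "Inf (norm ` C) < d + 1 / Suc n" by (simp add: d_def)
    then show ?thesis using cInf_lessD[of "norm ` C"] wC by fastforce
  qed
  then obtain x where xC: "\<And>n. x n \<in> C" and xd: "\<And>n. norm (x n) < d + 1 / Suc n"
    by metis
  have close: "(norm (a - b))\<^sup>2 \<le> 2 * (norm a)\<^sup>2 + 2 * (norm b)\<^sup>2 - 4 * d\<^sup>2"
    if "a \<in> C" "b \<in> C" for a b
  proof -
    have "(1/2) *\<^sub>R (a + b) \<in> C"
      using that by (simp add: C_def scaleR_scaleC scale add)
    then have "d\<^sup>2 \<le> (norm ((1/2) *\<^sub>R (a + b)))\<^sup>2" using d_le d0 power_mono by blast
    then show ?thesis using parallelogram[of a b] by (simp add: power_divide)
  qed
  have upper: "(\<lambda>n. d + 1 / Suc n) \<longlonglongrightarrow> d"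
    using tendsto_add[OF tendsto_const[of d] LIMSEQ_Suc[OF lim_1_over_n[where 'a = real]]]
    by simp
  have lim: "(\<lambda>n. norm (x n)) \<longlonglongrightarrow> d"
  proof (rule tendsto_sandwich[OF _ _ tendsto_const upper])
    show "\<forall>\<^sub>F n in sequentially. d \<le> norm (x n)"
      using d_le xC by simp
    show "\<forall>\<^sub>F n in sequentially. norm (x n) \<le> d + 1 / Suc n"
      using xd by (intro always_eventually allI less_imp_le)
  qed
  have "Cauchy x"
  proof (rule metric_CauchyI)
    fix e :: real assume e: "0 < e"
    have "(\<lambda>n. (norm (x n))\<^sup>2) \<longlonglongrightarrow> d\<^sup>2" using lim by (intro tendsto_intros)
    then have "\<forall>\<^sub>F n in sequentially. (norm (x n))\<^sup>2 < d\<^sup>2 + e\<^sup>2 / 4"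
      using e by (intro order_tendstoD) auto
    then obtain N where N: "\<And>n. n \<ge> N \<Longrightarrow> (norm (x n))\<^sup>2 < d\<^sup>2 + e\<^sup>2 / 4"
      unfolding eventually_sequentially by blast
    have "dist (x m) (x n) < e" if "m \<ge> N" "n \<ge> N" for m n
    proof -
      have "(norm (x m - x n))\<^sup>2 < e\<^sup>2"
        using close[OF xC[of m] xC[of n]] N[OF that(1)] N[OF that(2)] by linarith
      then show ?thesis using e by (simp add: dist_norm power_less_imp_less_base)
    qed
    then show "\<exists>M. \<forall>m\<ge>M. \<forall>n\<ge>M. dist (x m) (x n) < e" by blast
  qed
  then obtain u where u: "x \<longlonglongrightarrow> u" using Cauchy_convergent convergent_def by blast
  have "(\<lambda>n. f (x n)) \<longlonglongrightarrow> f u" using lin u by (rule bounded_linear.tendsto)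
  moreover have "(\<lambda>n. f (x n)) = (\<lambda>n. 1)" using xC by (auto simp: C_def)
  ultimately have fu: "f u = 1" by (simp add: LIMSEQ_const_iff)
  have nu: "norm u = d" using LIMSEQ_unique[OF lim tendsto_norm[OF u]] by simp
  have "u \<noteq> 0" using fu bound[of 0] by auto
  have orth: "cinner u v = 0" if "f v = 0" for v
    by (rule cinner_eq_zero_if_minimal) (auto simp: nu C_def add scale fu that intro!: d_le)
  have "f y = cinner y (complex_of_real (1 / (norm u)\<^sup>2) *\<^sub>C u)" for y
  proof -
    have "f (y - f y *\<^sub>C u) = 0"
      by (simp add: linear_simps[OF lin] scale fu)
    then have "cinner (y - f y *\<^sub>C u) u = 0" using orth cinner_commute by (metis complex_cnj_zero)
    then have "cinner y u = f y * complex_of_real ((norm u)\<^sup>2)"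
      by (simp add: cinner_diff_left cinner_scaleC_left cinner_self)
    then show ?thesis using \<open>u \<noteq> 0\<close> by (simp add: cinner_scaleC_right)
  qed
  then show ?thesis by blast
qed

type_synonym 'h op = "'h \<Rightarrow>\<^sub>L 'h"

text \<open>
  \<^typ>\<open>'h op\<close> consists of the bounded real-linear maps, so \<open>B(H)\<close> is a proper subset of it.
  The norm of \<^typ>\<open>'h op\<close> is the operator norm.
\<close>

definition bounded_ops :: "'h::complex_hilbert_space op set" where
  "bounded_ops = {T. \<forall>c x. blinfun_apply T (c *\<^sub>C x) = c *\<^sub>C blinfun_apply T x}"

lift_definition op_scaleC :: "complex \<Rightarrow> 'h::complex_hilbert_space op \<Rightarrow> 'h op"
  is "\<lambda>c T x. c *\<^sub>C T x"
proof -
  fix c and T :: "'h \<Rightarrow> 'h" assume T: "bounded_linear T"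
  obtain K where "\<And>x. norm (T x) \<le> norm x * K"
    using bounded_linear.bounded[OF T] by blast
  then have "norm (c *\<^sub>C T x) \<le> norm x * (cmod c * K)" for x
    using mult_left_mono[of "norm (T x)" "norm x * K" "cmod c"]
    by (simp add: norm_scaleC mult_ac)
  moreover have "c *\<^sub>C T (r *\<^sub>R x) = r *\<^sub>R (c *\<^sub>C T x)" for r x
    unfolding linear_simps(5)[OF T] by (simp add: scaleR_scaleC scaleC_scaleC mult.commute)
  ultimately show "bounded_linear (\<lambda>x. c *\<^sub>C T x)"
    by (intro bounded_linear_intro[where K = "cmod c * K"])
       (simp_all only: linear_simps(1)[OF T] scaleC_add_right)
qed

definition adj :: "'h::complex_hilbert_space op \<Rightarrow> 'h op" where
  "adj T = (THE S. \<forall>x y. cinner (blinfun_apply T x) y = cinner x (blinfun_apply S y))"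

lemma ex1_adjoint:
  fixes T :: "'h::complex_hilbert_space op"
  assumes "T \<in> bounded_ops"
  shows "\<exists>!S :: 'h op. \<forall>x y. cinner (T x) y = cinner x (S y)"
proof -
  note cs = cinner_cauchy_schwarz
  have Tc: "T (c *\<^sub>C x) = c *\<^sub>C T x" for c x using assms by (simp add: bounded_ops_def)
  have uniq: "a = b" if "\<And>x. cinner x a = cinner x b" for a b :: 'h
  proof -
    have "cinner (a - b) (a - b) = 0" using that by (simp add: cinner_diff_right)
    then show ?thesis by (simp add: cinner_self)
  qed
  have "\<exists>z. \<forall>x. cinner (T x) y = cinner x z" for y
  proof (rule riesz_representation[where K = "norm T * norm y"])
    show "cmod (cinner (T x) y) \<le> norm T * norm y * norm x" for x
      using cs[of "T x" y] mult_right_mono[OF norm_blinfun[of T x] norm_ge_zero[of y]]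
      by (simp add: mult_ac)
  qed (simp_all add: blinfun.add_right cinner_add_left Tc cinner_scaleC_left)
  then obtain g where g: "\<And>x y. cinner (T x) y = cinner x (g y)" by metis
  have "bounded_linear g"
  proof (rule bounded_linear_intro[where K = "norm T"])
    show "g (a + b) = g a + g b" for a b
      by (rule uniq) (simp add: g[symmetric] cinner_add_right)
    show "g (r *\<^sub>R a) = r *\<^sub>R g a" for r a
      by (rule uniq) (simp add: g[symmetric] cinner_scaleC_right scaleR_scaleC)
    show "norm (g y) \<le> norm y * norm T" for y
    proof (cases "g y = 0")
      case False
      have "complex_of_real ((norm (g y))\<^sup>2) = cinner (T (g y)) y"
        by (simp add: g cinner_self)
      then have "cmod (complex_of_real ((norm (g y))\<^sup>2)) \<le> norm (T (g y)) * norm y"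
        using cs[of "T (g y)" y] by simp
      then have "(norm (g y))\<^sup>2 \<le> norm (T (g y)) * norm y"
        unfolding norm_of_real by simp
      also have "\<dots> \<le> norm T * norm (g y) * norm y"
        by (intro mult_right_mono norm_blinfun) simp
      finally show ?thesis using False by (simp add: power2_eq_square mult_ac)
    qed simp
  qed
  then have "\<forall>x y. cinner (T x) y = cinner x (Blinfun g y)"
    by (simp add: g bounded_linear_Blinfun_apply)
  moreover have "S = S'" if "\<forall>x y. cinner (T x) y = cinner x (S y)"
      "\<forall>x y. cinner (T x) y = cinner x (S' y)" for S S' :: "'h op"
    using that by (intro blinfun_eqI uniq) metis
  ultimately show ?thesis by blast
qed

lemma cinner_adj: "T \<in> bounded_ops \<Longrightarrow> cinner (T x) y = cinner x (adj T y)"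
  using theI'[OF ex1_adjoint] unfolding adj_def by blast

definition abs_sq :: "'h::complex_hilbert_space op \<Rightarrow> 'h op" where
  "abs_sq T = adj T o\<^sub>L T"

definition positive_op :: "'h::complex_hilbert_space op \<Rightarrow> bool" where
  "positive_op T \<longleftrightarrow> (\<forall>x. cinner (blinfun_apply T x) x \<in> \<real>\<^sub>\<ge>\<^sub>0)"

definition op_le :: "'h::complex_hilbert_space op \<Rightarrow> 'h op \<Rightarrow> bool"  (infix \<open>\<preceq>\<close> 50) where
  "S \<preceq> T \<longleftrightarrow> positive_op (T - S)"


section \<open>Von Neumann algebras with a filtration\<close>

definition commutant :: "'h::complex_hilbert_space op set \<Rightarrow> 'h op set" where
  "commutant M = {S \<in> bounded_ops. \<forall>T\<in>M. S o\<^sub>L T = T o\<^sub>L S}"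

text \<open>
  A commutant is automatically a unital complex subalgebra of \<open>B(H)\<close>, so the two conditions
  below say that \<open>M\<close> is a *-subalgebra equal to its bicommutant.
\<close>

definition von_neumann_algebra :: "'h::complex_hilbert_space op set \<Rightarrow> bool" where
  "von_neumann_algebra M \<longleftrightarrow> (\<forall>T\<in>M. adj T \<in> M) \<and> commutant (commutant M) = M"

definition op_sup :: "'h::complex_hilbert_space op set \<Rightarrow> 'h op set \<Rightarrow> 'h op \<Rightarrow> bool" where
  "op_sup M D T \<longleftrightarrow> T \<in> M \<and> (\<forall>S\<in>D. S \<preceq> T) \<and> (\<forall>U\<in>M. (\<forall>S\<in>D. S \<preceq> U) \<longrightarrow> T \<preceq> U)"

definition pos_directed :: "'h::complex_hilbert_space op set \<Rightarrow> 'h op set \<Rightarrow> bool" where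
  "pos_directed M D \<longleftrightarrow> D \<noteq> {} \<and> D \<subseteq> {T \<in> M. positive_op T} \<and>
     (\<forall>S\<in>D. \<forall>T\<in>D. \<exists>U\<in>D. S \<preceq> U \<and> T \<preceq> U)"

text \<open>Normality is preservation of suprema of increasing nets of positive elements.\<close>

definition normal_faithful_unital_trace ::
    "'h::complex_hilbert_space op set \<Rightarrow> ('h op \<Rightarrow> complex) \<Rightarrow> bool" where
  "normal_faithful_unital_trace M \<tau> \<longleftrightarrow>
     (\<forall>S\<in>M. \<forall>T\<in>M. \<tau> (S + T) = \<tau> S + \<tau> T) \<and>
     (\<forall>c. \<forall>T\<in>M. \<tau> (op_scaleC c T) = c * \<tau> T) \<and>
     (\<forall>T\<in>M. positive_op T \<longrightarrow> \<tau> T \<in> \<real>\<^sub>\<ge>\<^sub>0) \<and>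
     (\<forall>S\<in>M. \<forall>T\<in>M. \<tau> (S o\<^sub>L T) = \<tau> (T o\<^sub>L S)) \<and>
     \<tau> id_blinfun = 1 \<and>
     (\<forall>T\<in>M. positive_op T \<and> \<tau> T = 0 \<longrightarrow> T = 0) \<and>
     (\<forall>D T. pos_directed M D \<and> op_sup M D T \<longrightarrow> Re (\<tau> T) = (SUP S\<in>D. Re (\<tau> S)))"

definition normal_conditional_expectation ::
    "'h::complex_hilbert_space op set \<Rightarrow> 'h op set \<Rightarrow> ('h op \<Rightarrow> 'h op) \<Rightarrow> bool" where
  "normal_conditional_expectation M N F \<longleftrightarrow>
     (\<forall>S\<in>M. \<forall>T\<in>M. F (S + T) = F S + F T) \<and>
     (\<forall>c. \<forall>T\<in>M. F (op_scaleC c T) = op_scaleC c (F T)) \<and>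
     (\<forall>T\<in>M. positive_op T \<longrightarrow> positive_op (F T)) \<and>
     (\<forall>T\<in>M. F T \<in> N) \<and>
     (\<forall>T\<in>N. F T = T) \<and>
     (\<forall>S\<in>N. \<forall>T\<in>M. \<forall>R\<in>N. F (S o\<^sub>L T o\<^sub>L R) = S o\<^sub>L F T o\<^sub>L R) \<and>
     (\<forall>D T. pos_directed M D \<and> op_sup M D T \<longrightarrow> op_sup N (F ` D) (F T))"

definition filtration ::
    "'h::complex_hilbert_space op set \<Rightarrow> (real \<Rightarrow> 'h op set) \<Rightarrow> bool" where
  "filtration M \<A> \<longleftrightarrow>
     (\<forall>t\<ge>0. von_neumann_algebra (\<A> t) \<and> \<A> t \<subseteq> M) \<and>
     (\<forall>s t. 0 \<le> s \<and> s \<le> t \<longrightarrow> \<A> s \<subseteq> \<A> t) \<and>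
     M = commutant (commutant (\<Union>t\<in>{0..}. \<A> t)) \<and>
     (\<forall>s\<ge>0. \<A> s = (\<Inter>t\<in>{s<..}. \<A> t))"

definition martingale ::
    "'h::complex_hilbert_space op set \<Rightarrow> (real \<Rightarrow> 'h op \<Rightarrow> 'h op) \<Rightarrow> (real \<Rightarrow> 'h op) \<Rightarrow> bool" where
  "martingale M E X \<longleftrightarrow>
     (\<forall>t\<ge>0. X t \<in> M) \<and> (\<forall>s t. 0 \<le> s \<and> s \<le> t \<longrightarrow> E s (X t) = X s)"

definition projections :: "'h::complex_hilbert_space op set \<Rightarrow> 'h op set" where
  "projections M = {e \<in> M. adj e = e \<and> e o\<^sub>L e = e}"

definition segal_right ::
    "'h::complex_hilbert_space op set \<Rightarrow> ('h op \<Rightarrow> complex) \<Rightarrow> (real \<Rightarrow> 'h op) \<Rightarrow> real \<Rightarrow> real \<Rightarrow> bool"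
where
  "segal_right M \<tau> X a b \<longleftrightarrow>
     (\<forall>\<epsilon>>0. \<exists>e\<in>projections M. Re (\<tau> e) > 1 - \<epsilon> \<and>
        (\<forall>\<eta>>0. \<exists>\<delta>>0. \<forall>s\<in>{a..b}. \<forall>t\<in>{a..b}. \<bar>t - s\<bar> < \<delta> \<longrightarrow>
           (X t - X s) o\<^sub>L e \<in> M \<and> norm ((X t - X s) o\<^sub>L e) \<le> \<eta>))"

definition segal_left ::
    "'h::complex_hilbert_space op set \<Rightarrow> ('h op \<Rightarrow> complex) \<Rightarrow> (real \<Rightarrow> 'h op) \<Rightarrow> real \<Rightarrow> real \<Rightarrow> bool"
where
  "segal_left M \<tau> X a b \<longleftrightarrow>
     (\<forall>\<epsilon>>0. \<exists>e\<in>projections M. Re (\<tau> e) > 1 - \<epsilon> \<and>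
        (\<forall>\<eta>>0. \<exists>\<delta>>0. \<forall>s\<in>{a..b}. \<forall>t\<in>{a..b}. \<bar>t - s\<bar> < \<delta> \<longrightarrow>
           e o\<^sub>L (X t - X s) \<in> M \<and> norm (e o\<^sub>L (X t - X s)) \<le> \<eta>))"

definition segal_continuous ::
    "'h::complex_hilbert_space op set \<Rightarrow> ('h op \<Rightarrow> complex) \<Rightarrow> (real \<Rightarrow> 'h op) \<Rightarrow> bool" where
  "segal_continuous M \<tau> X \<longleftrightarrow>
     (\<forall>a b. 0 \<le> a \<and> a \<le> b \<longrightarrow> segal_right M \<tau> X a b \<and> segal_left M \<tau> X a b)"


section \<open>The noncommutative \<open>L\<^sup>2\<close>-space\<close>

definition norm2 :: "('h::complex_hilbert_space op \<Rightarrow> complex) \<Rightarrow> 'h op \<Rightarrow> real" where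
  "norm2 \<tau> T = sqrt (Re (\<tau> (abs_sq T)))"

text \<open>
  \<open>L\<^sup>2(M)\<close> is the completion of \<open>M\<close> in \<^const>\<open>norm2\<close>. It is given by a complete space
  \<^typ>\<open>'k\<close> together with the canonical embedding \<open>\<iota>\<close> of \<open>M\<close>, a linear isometry with dense range;
  these data are unique up to a unitary map, and convergence in the norm of \<^typ>\<open>'k\<close> is
  \<open>L\<^sup>2\<close>-convergence.
\<close>

definition is_L2_space ::
    "'h::complex_hilbert_space op set \<Rightarrow> ('h op \<Rightarrow> complex) \<Rightarrow> ('h op \<Rightarrow> 'k::complex_hilbert_space) \<Rightarrow> bool"
where
  "is_L2_space M \<tau> \<iota> \<longleftrightarrow>
     (\<forall>S\<in>M. \<forall>T\<in>M. \<iota> (S + T) = \<iota> S + \<iota> T) \<and>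
     (\<forall>c. \<forall>T\<in>M. \<iota> (op_scaleC c T) = c *\<^sub>C \<iota> T) \<and>
     (\<forall>T\<in>M. norm (\<iota> T) = norm2 \<tau> T) \<and>
     closure (\<iota> ` M) = UNIV"


section \<open>Partitions, stochastic integrals and quadratic variation\<close>

text \<open>A partition \<open>0 = t\<^sub>0 < \<dots> < t\<^sub>m = t\<close> is the list \<open>[t\<^sub>0, \<dots>, t\<^sub>m]\<close>; for \<open>t = 0\<close> it is \<open>[0]\<close>.\<close>

definition partitions :: "real \<Rightarrow> real list set" where
  "partitions t = {\<theta>. \<theta> \<noteq> [] \<and> sorted_wrt (<) \<theta> \<and> hd \<theta> = 0 \<and> last \<theta> = t}"

text \<open>The increments are positive; \<open>0\<close> is inserted only to cover the partition without increments.\<close>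

definition mesh :: "real list \<Rightarrow> real" where
  "mesh \<theta> = Max (insert 0 ((\<lambda>k. \<theta> ! k - \<theta> ! (k - 1)) ` {1..<length \<theta>}))"

definition mesh_to_0 :: "real \<Rightarrow> real list filter" where
  "mesh_to_0 t = (INF \<delta>\<in>{0<..}. principal {\<theta> \<in> partitions t. mesh \<theta> < \<delta>})"

lemma eventually_mesh_to_0:
  "eventually P (mesh_to_0 t) \<longleftrightarrow> (\<exists>\<delta>>0. \<forall>\<theta>\<in>partitions t. mesh \<theta> < \<delta> \<longrightarrow> P \<theta>)"
  unfolding mesh_to_0_def
proof (subst eventually_INF_base)
  fix a b :: real assume "a \<in> {0<..}" "b \<in> {0<..}"
  then show "\<exists>x\<in>{0<..}. principal {\<theta> \<in> partitions t. mesh \<theta> < x} \<le>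
      inf (principal {\<theta> \<in> partitions t. mesh \<theta> < a}) (principal {\<theta> \<in> partitions t. mesh \<theta> < b})"
    by (intro bexI[of _ "min a b"]) auto
qed (auto simp: eventually_principal)

definition left_sum :: "(real \<Rightarrow> 'h::complex_hilbert_space op) \<Rightarrow> (real \<Rightarrow> 'h op) \<Rightarrow> real list \<Rightarrow> 'h op" where
  "left_sum X Y \<theta> = (\<Sum>k\<in>{1..<length \<theta>}. (X (\<theta> ! k) - X (\<theta> ! (k - 1))) o\<^sub>L Y (\<theta> ! (k - 1)))"

definition right_sum :: "(real \<Rightarrow> 'h::complex_hilbert_space op) \<Rightarrow> (real \<Rightarrow> 'h op) \<Rightarrow> real list \<Rightarrow> 'h op" where
  "right_sum Y X \<theta> = (\<Sum>k\<in>{1..<length \<theta>}. Y (\<theta> ! (k - 1)) o\<^sub>L (X (\<theta> ! k) - X (\<theta> ! (k - 1))))"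

definition left_integral ::
    "('h::complex_hilbert_space op \<Rightarrow> 'k::complex_hilbert_space) \<Rightarrow>
     (real \<Rightarrow> 'h op) \<Rightarrow> (real \<Rightarrow> 'h op) \<Rightarrow> real \<Rightarrow> 'k" where
  "left_integral \<iota> X Y t = Lim (mesh_to_0 t) (\<lambda>\<theta>. \<iota> (left_sum X Y \<theta>))"

definition right_integral ::
    "('h::complex_hilbert_space op \<Rightarrow> 'k::complex_hilbert_space) \<Rightarrow>
     (real \<Rightarrow> 'h op) \<Rightarrow> (real \<Rightarrow> 'h op) \<Rightarrow> real \<Rightarrow> 'k" where
  "right_integral \<iota> Y X t = Lim (mesh_to_0 t) (\<lambda>\<theta>. \<iota> (right_sum Y X \<theta>))"

definition quad_sum :: "(real \<Rightarrow> 'h::complex_hilbert_space op) \<Rightarrow> real list \<Rightarrow> 'h op" where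
  "quad_sum X \<theta> = (\<Sum>k\<in>{1..<length \<theta>}. abs_sq (X (\<theta> ! k) - X (\<theta> ! (k - 1))))"

definition quad_variation ::
    "('h::complex_hilbert_space op \<Rightarrow> 'k::complex_hilbert_space) \<Rightarrow> (real \<Rightarrow> 'h op) \<Rightarrow> real \<Rightarrow> 'k" where
  "quad_variation \<iota> X t = \<iota> (abs_sq (X t)) - \<iota> (abs_sq (X 0)) -
     (left_integral \<iota> (\<lambda>u. adj (X u)) X t + right_integral \<iota> (\<lambda>u. adj (X u)) X t)"

end

theory Submission
  imports Defs
begin

text \<open>
  Since \<open>|X(b) - X(a)|\<^sup>2 = |X(b)|\<^sup>2 - |X(a)|\<^sup>2 - (X(b)\<^sup>* - X(a)\<^sup>*) X(a) - X(a)\<^sup>* (X(b) - X(a))\<close>,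
  it suffices that the two Riemann sums converge in \<open>L\<^sup>2\<close>; they are adjoint to each other, so only the
  right sums matter. On a common refinement, the difference of the right sums of two partitions is a
  martingale transform \<open>\<Sum> D \<Delta>X\<close> with adapted \<open>D\<close>, whose terms are orthogonal.
  Segal continuity gives a projection \<open>e\<close> of trace close to \<open>1\<close> with \<open>D e\<close> uniformly small, so
  \<open>\<Sum> \<parallel>D e \<Delta>X\<parallel>\<^sub>2\<^sup>2\<close> is small. For \<open>p = 1 - e\<close> one has
  \<open>\<Sum> \<parallel>p \<Delta>X\<parallel>\<^sub>2\<^sup>2 = \<tau>(p Q) \<le> \<parallel>p\<parallel>\<^sub>2 \<parallel>Q\<parallel>\<^sub>2\<close> with \<open>Q = \<Sum> \<Delta>X \<Delta>X\<^sup>*\<close>, and \<open>\<parallel>Q\<parallel>\<^sub>2\<close> is bounded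
  independently of the partition because \<open>X\<close> is bounded in operator norm on \<open>[0, t]\<close>.
\<close>

section \<open>Adjoints and positivity\<close>

lemma cinner_left_eqI:
  fixes a b :: "'h::complex_hilbert_space"
  assumes "\<And>x. cinner x a = cinner x b"
  shows "a = b"
proof -
  have "cinner (a - b) (a - b) = 0" using assms by (simp add: cinner_diff_right)
  then show ?thesis by (simp add: cinner_self)
qed

lemma adj_eqI:
  assumes "T \<in> bounded_ops" "\<And>x y. cinner (blinfun_apply T x) y = cinner x (blinfun_apply S y)"
  shows "adj T = S"
  using assms by (intro blinfun_eqI cinner_left_eqI) (simp add: cinner_adj[symmetric])

lemma cinner_adj_left:
  assumes "T \<in> bounded_ops"
  shows "cinner (blinfun_apply (adj T) x) y = cinner x (blinfun_apply T y)"
  by (metis assms cinner_adj cinner_commute)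

lemma adj_in_bounded_ops:
  assumes T: "T \<in> bounded_ops"
  shows "adj T \<in> bounded_ops"
proof -
  have "adj T (c *\<^sub>C y) = c *\<^sub>C adj T y" for c y
  proof (rule cinner_left_eqI)
    fix x show "cinner x (adj T (c *\<^sub>C y)) = cinner x (c *\<^sub>C adj T y)"
      by (simp only: cinner_adj[OF T, symmetric] cinner_scaleC_right)
  qed
  then show ?thesis by (simp add: bounded_ops_def)
qed

lemma adj_adj: "T \<in> bounded_ops \<Longrightarrow> adj (adj T) = T"
  by (simp add: adj_eqI adj_in_bounded_ops cinner_adj_left)

text \<open>\<open>norm (adj T y)\<close> squared equals <T (adj T y), y>. Cauchy-Schwarz then
  leaves a factor \<open>norm (adj T y)\<close> to cancel, whence the case split on its
  vanishing.\<close>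

lemma norm_adj_le:
  assumes T: "T \<in> bounded_ops"
  shows "norm (adj T) \<le> norm T"
proof (rule norm_blinfun_bound)
  fix y
  show "norm (adj T y) \<le> norm T * norm y"
  proof (cases "adj T y = 0")
    case False
    have "complex_of_real ((norm (adj T y))\<^sup>2) = cinner (T (adj T y)) y"
      by (simp add: cinner_adj[OF T] cinner_self)
    then have "cmod (complex_of_real ((norm (adj T y))\<^sup>2)) \<le> norm (T (adj T y)) * norm y"
      using cinner_cauchy_schwarz[of "T (adj T y)" y] by simp
    then have "(norm (adj T y))\<^sup>2 \<le> norm (T (adj T y)) * norm y"
      unfolding norm_of_real by simp
    also have "\<dots> \<le> norm T * norm (adj T y) * norm y"
      by (intro mult_right_mono norm_blinfun) simp
    finally show ?thesis using False by (simp add: power2_eq_square mult_ac)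
  qed simp
qed simp

lemma norm_adj: "T \<in> bounded_ops \<Longrightarrow> norm (adj T) = norm T"
  by (metis adj_adj adj_in_bounded_ops antisym norm_adj_le)

lemmas op_simps = blinfun.bilinear_simps op_scaleC.rep_eq

lemma bounded_ops_compose: "S \<in> bounded_ops \<Longrightarrow> T \<in> bounded_ops \<Longrightarrow> S o\<^sub>L T \<in> bounded_ops"
  and bounded_ops_add: "S \<in> bounded_ops \<Longrightarrow> T \<in> bounded_ops \<Longrightarrow> S + T \<in> bounded_ops"
  and bounded_ops_scaleC: "T \<in> bounded_ops \<Longrightarrow> op_scaleC c T \<in> bounded_ops"
  and bounded_ops_id: "id_blinfun \<in> bounded_ops"
  by (auto simp: bounded_ops_def op_simps scaleC_add_right scaleC_scaleC mult.commute)

text \<open>The closure, trace and adjoint rules are available for sums and complex multiples first;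
  negation and subtraction are reduced to these.\<close>

lemma op_minus_eq: "- T = op_scaleC (- 1) T"
proof (rule blinfun_eqI)
  fix x show "(- T) x = op_scaleC (- 1) T x"
    using scaleR_scaleC[of "-1" "T x"] by (simp add: op_simps)
qed

lemma op_diff_eq: "S - T = S + op_scaleC (- 1) T"
  by (simp flip: op_minus_eq)

lemma adj_compose:
  assumes "S \<in> bounded_ops" "T \<in> bounded_ops"
  shows "adj (S o\<^sub>L T) = adj T o\<^sub>L adj S"
  by (rule adj_eqI) (simp_all add: assms bounded_ops_compose cinner_adj)

lemma adj_add:
  assumes "S \<in> bounded_ops" "T \<in> bounded_ops"
  shows "adj (S + T) = adj S + adj T"
  by (rule adj_eqI)
     (simp_all add: assms bounded_ops_add cinner_adj op_simps cinner_add_left cinner_add_right)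

lemma adj_scaleC:
  assumes "T \<in> bounded_ops"
  shows "adj (op_scaleC c T) = op_scaleC (cnj c) (adj T)"
  by (rule adj_eqI)
     (simp_all add: assms bounded_ops_scaleC cinner_adj op_simps cinner_scaleC_left cinner_scaleC_right)

lemma adj_diff:
  assumes "S \<in> bounded_ops" "T \<in> bounded_ops"
  shows "adj (S - T) = adj S - adj T"
  by (simp add: op_diff_eq adj_add adj_scaleC assms bounded_ops_scaleC)

lemma adj_id: "adj id_blinfun = id_blinfun"
  by (rule adj_eqI) (auto simp: bounded_ops_id)

section \<open>Commutants and the algebraic closure of von Neumann algebras\<close>

lemma commutant_subset: "commutant M \<subseteq> bounded_ops"
  by (auto simp: commutant_def)

lemma commutant_compose:
  assumes "S \<in> commutant M" "T \<in> commutant M"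
  shows "S o\<^sub>L T \<in> commutant M"
proof -
  have "(S o\<^sub>L T) o\<^sub>L U = U o\<^sub>L (S o\<^sub>L T)" if "U \<in> M" for U
    using assms that unfolding commutant_def
    by (metis (mono_tags, lifting) blinfun_apply_blinfun_compose blinfun_eqI mem_Collect_eq)
  then show ?thesis using assms by (simp add: commutant_def bounded_ops_compose)
qed

lemma commutant_add: "S \<in> commutant M \<Longrightarrow> T \<in> commutant M \<Longrightarrow> S + T \<in> commutant M"
  by (simp add: commutant_def bounded_ops_add bounded_bilinear.add_left[OF bounded_bilinear_blinfun_compose]
      bounded_bilinear.add_right[OF bounded_bilinear_blinfun_compose])

lemma op_scaleC_compose_left: "op_scaleC c S o\<^sub>L T = op_scaleC c (S o\<^sub>L T)"
  by (rule blinfun_eqI) (simp add: op_simps)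

text \<open>The type \<open>'h op\<close> contains all bounded real-linear maps, so pulling a
  complex scalar through S requires S to be complex-linear.\<close>

lemma op_scaleC_compose_right: "S \<in> bounded_ops \<Longrightarrow> S o\<^sub>L op_scaleC c T = op_scaleC c (S o\<^sub>L T)"
  by (rule blinfun_eqI) (simp add: op_simps bounded_ops_def)

lemma commutant_scaleC:
  "M \<subseteq> bounded_ops \<Longrightarrow> T \<in> commutant M \<Longrightarrow> op_scaleC c T \<in> commutant M"
  by (auto simp: commutant_def bounded_ops_scaleC op_scaleC_compose_left op_scaleC_compose_right subset_iff)

lemma commutant_id: "id_blinfun \<in> commutant M"
  by (auto simp: commutant_def bounded_ops_id intro: blinfun_eqI)

text \<open>M is the commutant of \<open>commutant M\<close>, so it inherits the closure properties
  of commutants; closure under adjoints is part of the definition.\<close>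

lemma von_neumann_algebra_closed:
  assumes "von_neumann_algebra M"
  shows "M \<subseteq> bounded_ops" "id_blinfun \<in> M"
    and "\<And>T. T \<in> M \<Longrightarrow> adj T \<in> M"
    and "\<And>S T. S \<in> M \<Longrightarrow> T \<in> M \<Longrightarrow> S o\<^sub>L T \<in> M"
    and "\<And>S T. S \<in> M \<Longrightarrow> T \<in> M \<Longrightarrow> S + T \<in> M"
    and "\<And>c T. T \<in> M \<Longrightarrow> op_scaleC c T \<in> M"
    and "\<And>S T. S \<in> M \<Longrightarrow> T \<in> M \<Longrightarrow> S - T \<in> M"
    and "0 \<in> M"
proof -
  have M: "commutant (commutant M) = M"
    using assms by (simp add: von_neumann_algebra_def)
  show "M \<subseteq> bounded_ops" "id_blinfun \<in> M"
    and "\<And>S T. S \<in> M \<Longrightarrow> T \<in> M \<Longrightarrow> S o\<^sub>L T \<in> M"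
    and add: "\<And>S T. S \<in> M \<Longrightarrow> T \<in> M \<Longrightarrow> S + T \<in> M"
    using commutant_subset[of "commutant M"] commutant_id[of "commutant M"]
      commutant_compose[of _ "commutant M"] commutant_add[of _ "commutant M"] M by auto
  show scale: "op_scaleC c T \<in> M" if "T \<in> M" for c T
    using commutant_scaleC[OF commutant_subset, of T M c] that M by simp
  show "S - T \<in> M" if "S \<in> M" "T \<in> M" for S T
    unfolding op_diff_eq by (intro add scale that)
  then show "0 \<in> M" using \<open>id_blinfun \<in> M\<close> by (metis cancel_comm_monoid_add_class.diff_cancel)
qed (use assms in \<open>auto simp: von_neumann_algebra_def\<close>)

section \<open>Positive operators through their quadratic forms\<close>

lemma positive_op_iff:
  "positive_op T \<longleftrightarrow> (\<forall>x. 0 \<le> Re (cinner (blinfun_apply T x) x) \<and> Im (cinner (blinfun_apply T x) x) = 0)"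
  by (auto simp: positive_op_def complex_nonneg_Reals_iff)

lemma cinner_abs_sq:
  "T \<in> bounded_ops \<Longrightarrow> cinner (abs_sq T x) x = complex_of_real ((norm (T x))\<^sup>2)"
  by (simp add: abs_sq_def cinner_adj_left cinner_self)

lemma positive_abs_sq: "T \<in> bounded_ops \<Longrightarrow> positive_op (abs_sq T)"
  by (simp add: positive_op_iff cinner_abs_sq)

lemma positive_scaleC_id: "0 \<le> c \<Longrightarrow> positive_op (op_scaleC (complex_of_real c) id_blinfun)"
  by (simp add: positive_op_iff op_simps cinner_scaleC_left cinner_self del: of_real_mult of_real_power flip: of_real_mult)

text \<open>Cauchy-Schwarz bounds <T x, x> by \<open>norm T\<close> times the square of
  \<open>norm x\<close>. This writes a self-adjoint element as the difference of two positive ones,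
  c and c - T with c the scalar operator \<open>norm T\<close>.\<close>

lemma positive_norm_minus:
  assumes T: "T \<in> bounded_ops" and "adj T = T"
  shows "positive_op (op_scaleC (complex_of_real (norm T)) id_blinfun - T)"
  unfolding positive_op_iff
proof
  fix x
  have "cinner (T x) x = cnj (cinner (T x) x)"
    by (metis assms cinner_adj cinner_commute)
  then have im: "Im (cinner (T x) x) = 0"
    by (metis complex_cnj_cancel_iff equal_neg_zero cnj.simps(2))
  have "Re (cinner (T x) x) \<le> norm (T x) * norm x"
    using cinner_cauchy_schwarz complex_Re_le_cmod order_trans by blast
  also have "\<dots> \<le> norm T * norm x * norm x"
    by (intro mult_right_mono norm_blinfun) simp
  finally show "0 \<le> Re (cinner ((op_scaleC (complex_of_real (norm T)) id_blinfun - T) x) x) \<and>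
    Im (cinner ((op_scaleC (complex_of_real (norm T)) id_blinfun - T) x) x) = 0"
    using im by (simp add: op_simps cinner_diff_left cinner_scaleC_left cinner_self power2_eq_square
      flip: of_real_mult)
qed

text \<open>As quadratic forms this is just \<open>norm (S (T x)) \<le> K * norm (T x)\<close>. It
  transfers operator norm bounds to the trace norm.\<close>

lemma positive_norm_abs_sq:
  assumes S: "S \<in> bounded_ops" and T: "T \<in> bounded_ops" and K: "norm S \<le> K"
  shows "positive_op (op_scaleC (complex_of_real (K\<^sup>2)) (abs_sq T) - abs_sq (S o\<^sub>L T))"
  unfolding positive_op_iff
proof
  fix x
  have "norm (S (T x)) \<le> K * norm (T x)"
    by (meson K norm_blinfun mult_right_mono norm_ge_zero order_trans)
  then have "(norm (S (T x)))\<^sup>2 \<le> K\<^sup>2 * (norm (T x))\<^sup>2"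
    by (metis norm_ge_zero power_mono power_mult_distrib)
  moreover have "cinner ((op_scaleC (complex_of_real (K\<^sup>2)) (abs_sq T) - abs_sq (S o\<^sub>L T)) x) x =
      complex_of_real (K\<^sup>2 * (norm (T x))\<^sup>2 - (norm (S (T x)))\<^sup>2)"
    by (simp add: blinfun.diff_left op_scaleC.rep_eq cinner_diff_left cinner_scaleC_left cinner_abs_sq S T
      bounded_ops_compose)
  ultimately show "0 \<le> Re (cinner ((op_scaleC (complex_of_real (K\<^sup>2)) (abs_sq T) - abs_sq (S o\<^sub>L T)) x) x)
    \<and> Im (cinner ((op_scaleC (complex_of_real (K\<^sup>2)) (abs_sq T) - abs_sq (S o\<^sub>L T)) x) x) = 0"
    by simp
qed

text \<open>Polarization: the vectors x + y and x + \<i> y give the sum and the difference of <D x,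
  y> and <D y, x>, so both vanish. The second uses complex linearity of D.\<close>

lemma op_eq_zero_if_quadratic_form_zero:
  assumes D: "D \<in> bounded_ops" and zero: "\<And>x. cinner (blinfun_apply D x) x = 0"
  shows "D = 0"
proof (rule blinfun_eqI)
  fix x
  have Dc: "D (c *\<^sub>C z) = c *\<^sub>C D z" for c z using D by (simp add: bounded_ops_def)
  have "cinner y (D x) = cinner y 0" for y
  proof -
    have 1: "cinner (D x) y + cinner (D y) x = 0"
      using zero[of "x + y"] zero[of x] zero[of y]
      by (simp add: blinfun.add_right cinner_add_left cinner_add_right add_ac)
    have 2: "- \<i> * cinner (D x) y + \<i> * cinner (D y) x = 0"
      using zero[of "x + \<i> *\<^sub>C y"] zero[of x] zero[of y]
      by (simp add: blinfun.add_right cinner_add_left cinner_add_right Dc cinner_scaleC_left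
          cinner_scaleC_right)
    from 2 have "\<i> * (cinner (D y) x - cinner (D x) y) = 0" by (simp add: algebra_simps)
    with 1 have "cinner (D x) y = 0" by (simp add: algebra_simps)
    then show ?thesis by (metis cinner_commute cinner_zero_right complex_cnj_zero)
  qed
  then show "D x = blinfun_apply 0 x" by (metis cinner_left_eqI zero_blinfun.rep_eq)
qed

text \<open>A positive operator has a real quadratic form, so T and \<open>adj T\<close> have the
  same form and agree by polarization.\<close>

lemma adj_positive:
  assumes T: "T \<in> bounded_ops" and pos: "positive_op T"
  shows "adj T = T"
proof -
  have "cinner ((adj T - T) x) x = 0" for x
  proof -
    have "cinner (adj T x) x = cnj (cinner (T x) x)"
      by (metis T cinner_adj_left cinner_commute)
    then show ?thesis
      using pos by (simp add: positive_op_iff blinfun.diff_left cinner_diff_left complex_eq_iff)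
  qed
  then have "adj T - T = 0"
    using T by (intro op_eq_zero_if_quadratic_form_zero)
      (simp_all add: op_diff_eq bounded_ops_add bounded_ops_scaleC adj_in_bounded_ops)
  then show ?thesis by simp
qed

text \<open>R and S are the real and imaginary parts (T + adj T)/2 and (T - adj T)/(2\<i>).\<close>

lemma self_adjoint_decomposition:
  assumes M: "von_neumann_algebra M" and T: "T \<in> M"
  obtains R S where "R \<in> M" "S \<in> M" "adj R = R" "adj S = S"
    "T = R + op_scaleC \<i> S" "adj T = R + op_scaleC (- \<i>) S"
proof
  note cl = von_neumann_algebra_closed[OF M]
  have Tb: "T \<in> bounded_ops" using cl T by blast
  note b = Tb adj_in_bounded_ops[OF Tb] bounded_ops_add bounded_ops_scaleC
  let ?R = "op_scaleC (1/2) (T + adj T)" and ?S = "op_scaleC (- \<i> / 2) (T + op_scaleC (- 1) (adj T))"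
  show "?R \<in> M" "?S \<in> M" using cl T by auto
  \<comment> \<open>The unit and zero laws for complex scalars follow from those for real
    scalars.\<close>
  have one: "1 *\<^sub>C x = x" and null: "0 *\<^sub>C x = 0" for x :: 'a
    using scaleR_scaleC[of 1 x] scaleR_scaleC[of 0 x] by simp_all
  have split: "(1/2) *\<^sub>C (x + y) + (1/2) *\<^sub>C (x + (- 1) *\<^sub>C y) = x" for x y :: 'a
  proof -
    have "(1/2) *\<^sub>C (x + y) + (1/2) *\<^sub>C (x + (- 1) *\<^sub>C y) =
        ((1/2) *\<^sub>C x + (1/2) *\<^sub>C x) + ((1/2) *\<^sub>C y + (- 1/2) *\<^sub>C y)"
      by (simp add: scaleC_add_right scaleC_scaleC)
    also have "\<dots> = x"
      by (simp add: scaleC_add_left[symmetric] one null)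
    finally show ?thesis .
  qed
  have split': "(1/2) *\<^sub>C (x + y) + (- 1/2) *\<^sub>C (x + (- 1) *\<^sub>C y) = y" for x y :: 'a
  proof -
    have "(1/2) *\<^sub>C (x + y) + (- 1/2) *\<^sub>C (x + (- 1) *\<^sub>C y) =
        ((1/2) *\<^sub>C x + (- 1/2) *\<^sub>C x) + ((1/2) *\<^sub>C y + (1/2) *\<^sub>C y)"
      by (simp add: scaleC_add_right scaleC_scaleC)
    also have "\<dots> = y"
      by (simp add: scaleC_add_left[symmetric] one null)
    finally show ?thesis .
  qed
  show "adj ?R = ?R"
    by (simp add: adj_scaleC adj_add adj_adj b add.commute)
  show "adj ?S = ?S"
    by (rule blinfun_eqI)
       (simp add: adj_scaleC adj_add adj_adj b add.commute op_simps scaleC_add_right scaleC_scaleC)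
  show "T = ?R + op_scaleC \<i> ?S"
    by (rule blinfun_eqI) (simp add: plus_blinfun.rep_eq op_scaleC.rep_eq scaleC_scaleC split)
  show "adj T = ?R + op_scaleC (- \<i>) ?S"
    by (rule blinfun_eqI) (simp add: plus_blinfun.rep_eq op_scaleC.rep_eq scaleC_scaleC split' del: divide_minus_left)
qed

lemmas compose_distrib =
  bounded_bilinear.add_left[OF bounded_bilinear_blinfun_compose]
  bounded_bilinear.add_right[OF bounded_bilinear_blinfun_compose]
  bounded_bilinear.diff_left[OF bounded_bilinear_blinfun_compose]
  bounded_bilinear.diff_right[OF bounded_bilinear_blinfun_compose]

lemma compose_assoc: "(S o\<^sub>L T) o\<^sub>L U = S o\<^sub>L (T o\<^sub>L U)"
  by (rule blinfun_eqI) simp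

lemma compose_id [simp]: "id_blinfun o\<^sub>L T = T" "T o\<^sub>L id_blinfun = T"
  by (auto intro: blinfun_eqI)

lemma positive_op_add: "positive_op S \<Longrightarrow> positive_op T \<Longrightarrow> positive_op (S + T)"
  by (simp add: positive_op_iff plus_blinfun.rep_eq cinner_add_left)

section \<open>Conditional expectations\<close>

text \<open>For self-adjoint S, both c and c - S are positive, where c is the scalar operator
  \<open>norm S\<close>. Their images are positive, hence self-adjoint, and so is F S. Complex
  linearity extends this to all T.\<close>

lemma conditional_expectation_adj:
  fixes M N :: "'h::complex_hilbert_space op set"
  assumes M: "von_neumann_algebra M" and N: "von_neumann_algebra N"
    and F: "normal_conditional_expectation M N F" and T: "T \<in> M"
  shows "F (adj T) = adj (F T)"
proof -
  note cl = von_neumann_algebra_closed[OF M]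
  note clN = von_neumann_algebra_closed[OF N]
  have Fadd: "\<And>S T. S \<in> M \<Longrightarrow> T \<in> M \<Longrightarrow> F (S + T) = F S + F T"
    and Fscale: "\<And>c T. T \<in> M \<Longrightarrow> F (op_scaleC c T) = op_scaleC c (F T)"
    and Fpos: "\<And>T. T \<in> M \<Longrightarrow> positive_op T \<Longrightarrow> positive_op (F T)"
    and FN: "\<And>T. T \<in> M \<Longrightarrow> F T \<in> N"
    using F by (simp_all add: normal_conditional_expectation_def)
  have Fb: "F S \<in> bounded_ops" if "S \<in> M" for S using FN that clN(1) by blast
  have selfadj: "adj (F S) = F S" if S: "S \<in> M" "adj S = S" for S
  proof -
    define c :: "'h op" where "c = op_scaleC (complex_of_real (norm S)) id_blinfun"
    have cM: "c \<in> M" using cl by (simp add: c_def)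
    have "positive_op (c - S)" unfolding c_def using S cl by (intro positive_norm_minus) auto
    then have 1: "adj (F (c - S)) = F (c - S)" using cM S cl by (intro adj_positive Fb Fpos) auto
    have "positive_op c" by (simp add: c_def positive_scaleC_id)
    then have 2: "adj (F c) = F c" using cM by (intro adj_positive Fb Fpos) auto
    have "F c = F (c - S) + F S" using Fadd[of "c - S" S] cM S cl by simp
    then have "F S = F c - F (c - S)" by simp
    then show ?thesis using 1 2 by (simp add: adj_diff Fb cM S cl)
  qed
  obtain R S where RS: "R \<in> M" "S \<in> M" "adj R = R" "adj S = S"
    "T = R + op_scaleC \<i> S" "adj T = R + op_scaleC (- \<i>) S"
    using self_adjoint_decomposition[OF M T] .
  then show ?thesis
    by (simp add: Fadd Fscale cl adj_add adj_scaleC Fb bounded_ops_scaleC selfadj)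
qed

text \<open>Kadison's inequality \<open>F(T)\<^sup>* F(T) \<le> F(T\<^sup>* T)\<close> comes from expanding \<open>F(|T - F(T)|\<^sup>2) \<ge> 0\<close>.\<close>

lemma conditional_expectation_norm_le:
  fixes M N :: "'h::complex_hilbert_space op set"
  assumes M: "von_neumann_algebra M" and N: "von_neumann_algebra N" and sub: "N \<subseteq> M"
    and F: "normal_conditional_expectation M N F" and T: "T \<in> M"
  shows "norm (F T) \<le> norm T"
proof (rule norm_blinfun_bound)
  note cl = von_neumann_algebra_closed[OF M]
  note clN = von_neumann_algebra_closed[OF N]
  have Fadd: "\<And>S T. S \<in> M \<Longrightarrow> T \<in> M \<Longrightarrow> F (S + T) = F S + F T"
    and Fscale: "\<And>c T. T \<in> M \<Longrightarrow> F (op_scaleC c T) = op_scaleC c (F T)"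
    and Fpos: "\<And>T. T \<in> M \<Longrightarrow> positive_op T \<Longrightarrow> positive_op (F T)"
    and FN: "\<And>T. T \<in> M \<Longrightarrow> F T \<in> N"
    and Fid: "\<And>T. T \<in> N \<Longrightarrow> F T = T"
    and Fmod: "\<And>S T R. S \<in> N \<Longrightarrow> T \<in> M \<Longrightarrow> R \<in> N \<Longrightarrow> F (S o\<^sub>L T o\<^sub>L R) = S o\<^sub>L F T o\<^sub>L R"
    using F by (simp_all add: normal_conditional_expectation_def)
  have Fdiff: "F (S - T) = F S - F T" if "S \<in> M" "T \<in> M" for S T
    using Fadd[of "S - T" T] that cl by simp
  define Y where "Y = F T"
  have Y: "Y \<in> N" "Y \<in> M" using FN T sub by (auto simp: Y_def)
  have b: "T \<in> bounded_ops" "Y \<in> bounded_ops" using T Y cl by auto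
  \<comment> \<open>The module property gives this with the identity as outer left factor, since F
    maps \<open>adj T\<close> to \<open>adj Y\<close>.\<close>
  have 1: "F (adj T o\<^sub>L Y) = adj Y o\<^sub>L Y"
    using Fmod[of id_blinfun "adj T" Y] conditional_expectation_adj[OF M N F T] T Y cl clN
    by (simp add: Y_def)
  have 2: "F (adj Y o\<^sub>L T) = adj Y o\<^sub>L Y"
    using Fmod[of "adj Y" T id_blinfun] T Y cl clN by (simp add: Y_def)
  have 3: "F (adj Y o\<^sub>L Y) = adj Y o\<^sub>L Y" using Fid Y clN by simp
  have "abs_sq (T - Y) = (adj T o\<^sub>L T) - (adj T o\<^sub>L Y) - ((adj Y o\<^sub>L T) - (adj Y o\<^sub>L Y))"
    by (simp add: abs_sq_def adj_diff b compose_distrib)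
  then have "F (abs_sq (T - Y)) = F (abs_sq T) - abs_sq Y"
    by (simp add: Fdiff 1 2 3 T Y cl abs_sq_def)
  moreover have "positive_op (F (abs_sq (T - Y)))"
    using T Y cl by (intro Fpos positive_abs_sq) (auto simp: abs_sq_def)
  ultimately have p1: "positive_op (F (abs_sq T) - abs_sq Y)" by simp
  define c where "c = complex_of_real ((norm T)\<^sup>2)"
  have "positive_op (op_scaleC c (abs_sq (id_blinfun :: 'h op)) - abs_sq (T o\<^sub>L id_blinfun))"
    unfolding c_def using b bounded_ops_id by (intro positive_norm_abs_sq) auto
  then have "positive_op (op_scaleC c id_blinfun - abs_sq T)"
    by (simp add: abs_sq_def adj_id)
  then have "positive_op (F (op_scaleC c id_blinfun - abs_sq T))"
    using T cl by (intro Fpos) (auto simp: abs_sq_def)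
  moreover have "F (op_scaleC c id_blinfun - abs_sq T) = op_scaleC c id_blinfun - F (abs_sq T)"
    using T cl clN by (simp add: Fdiff Fscale Fid abs_sq_def)
  ultimately have "positive_op (op_scaleC c id_blinfun - F (abs_sq T))" by simp
  \<comment> \<open>Chaining |Y|^2 \<le> F(|T|^2) \<le> c yields the operator form of the norm
    bound.\<close>
  from positive_op_add[OF this p1] have p: "positive_op (op_scaleC c id_blinfun - abs_sq Y)" by simp
  fix x
  have "(norm (Y x))\<^sup>2 \<le> (norm T)\<^sup>2 * (norm x)\<^sup>2"
    using p[unfolded positive_op_iff, rule_format, of x]
    by (simp add: minus_blinfun.rep_eq op_scaleC.rep_eq cinner_diff_left cinner_scaleC_left
        cinner_abs_sq b cinner_self c_def flip: of_real_mult of_real_power)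
  then have "(norm (Y x))\<^sup>2 \<le> (norm T * norm x)\<^sup>2" by (simp add: power_mult_distrib)
  then show "norm (F T x) \<le> norm T * norm x"
    unfolding Y_def[symmetric] by (rule power2_le_imp_le) simp
qed simp

section \<open>The trace inner product\<close>

locale tracial_L2 =
  fixes A :: "'h::complex_hilbert_space op set"
    and \<tau> :: "'h op \<Rightarrow> complex"
    and \<iota> :: "'h op \<Rightarrow> 'k::complex_hilbert_space"
  assumes vn: "von_neumann_algebra A"
    and trace: "normal_faithful_unital_trace A \<tau>"
    and L2: "is_L2_space A \<tau> \<iota>"
begin

lemmas closed = von_neumann_algebra_closed[OF vn]

lemma bounded: "T \<in> A \<Longrightarrow> T \<in> bounded_ops"
  using closed(1) by blast

lemma trace_add: "S \<in> A \<Longrightarrow> T \<in> A \<Longrightarrow> \<tau> (S + T) = \<tau> S + \<tau> T"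
  and trace_scaleC: "T \<in> A \<Longrightarrow> \<tau> (op_scaleC c T) = c * \<tau> T"
  and trace_commute: "S \<in> A \<Longrightarrow> T \<in> A \<Longrightarrow> \<tau> (S o\<^sub>L T) = \<tau> (T o\<^sub>L S)"
  and trace_id: "\<tau> id_blinfun = 1"
  using trace by (simp_all add: normal_faithful_unital_trace_def)

lemma trace_positive:
  assumes "T \<in> A" "positive_op T"
  shows "0 \<le> Re (\<tau> T)" "Im (\<tau> T) = 0"
  using trace assms by (auto simp: normal_faithful_unital_trace_def complex_nonneg_Reals_iff)

lemma trace_diff: "S \<in> A \<Longrightarrow> T \<in> A \<Longrightarrow> \<tau> (S - T) = \<tau> S - \<tau> T"
  using trace_add[of "S - T" T] closed by simp

lemma trace_0: "\<tau> 0 = 0"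
  using trace_diff[of 0 0] closed(8) by simp

text \<open>T is again a difference of two positive elements, and the trace is real on each.\<close>

lemma Im_trace_self_adjoint:
  assumes T: "T \<in> A" "adj T = T"
  shows "Im (\<tau> T) = 0"
proof -
  define c :: "'h op" where "c = op_scaleC (complex_of_real (norm T)) id_blinfun"
  have c: "c \<in> A" "positive_op c" using closed by (simp_all add: c_def positive_scaleC_id)
  have "positive_op (c - T)" unfolding c_def using T bounded by (intro positive_norm_minus) auto
  then have "Im (\<tau> (c - T)) = 0" using c T closed by (intro trace_positive) auto
  then show ?thesis using trace_positive(2)[OF c] c T by (simp add: trace_diff)
qed

lemma Re_trace_adj:
  assumes T: "T \<in> A"
  shows "Re (\<tau> (adj T)) = Re (\<tau> T)"
proof -
  obtain R S where "R \<in> A" "S \<in> A" "adj R = R" "adj S = S"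
    "T = R + op_scaleC \<i> S" "adj T = R + op_scaleC (- \<i>) S"
    using self_adjoint_decomposition[OF vn T] .
  then show ?thesis by (simp add: trace_add trace_scaleC closed Im_trace_self_adjoint)
qed

lemma embed_add: "S \<in> A \<Longrightarrow> T \<in> A \<Longrightarrow> \<iota> (S + T) = \<iota> S + \<iota> T"
  using L2 by (simp add: is_L2_space_def)

lemma embed_diff: "S \<in> A \<Longrightarrow> T \<in> A \<Longrightarrow> \<iota> (S - T) = \<iota> S - \<iota> T"
  using embed_add[of "S - T" T] closed by simp

lemma abs_sq_closed: "T \<in> A \<Longrightarrow> abs_sq T \<in> A"
  by (simp add: abs_sq_def closed)

lemma norm_embed_sq: "T \<in> A \<Longrightarrow> (norm (\<iota> T))\<^sup>2 = Re (\<tau> (abs_sq T))"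
  using L2 trace_positive(1)[OF abs_sq_closed positive_abs_sq[OF bounded], of T]
  by (simp add: is_L2_space_def norm2_def)

text \<open>Traciality: T (adj T) and (adj T) T have the same trace.\<close>

lemma norm_embed_adj: "T \<in> A \<Longrightarrow> norm (\<iota> (adj T)) = norm (\<iota> T)"
proof -
  assume T: "T \<in> A"
  have "(norm (\<iota> (adj T)))\<^sup>2 = (norm (\<iota> T))\<^sup>2"
    using T by (simp add: norm_embed_sq closed abs_sq_def adj_adj bounded trace_commute[of T])
  then show ?thesis by (simp add: power2_eq_iff_nonneg)
qed

text \<open>The embedding is known only to be a linear isometry, so its inner product is recovered
  by expanding |S + T|^2. The two cross terms are adjoint to each other, hence have the same real
  trace.\<close>

lemma Re_cinner_embed:
  assumes S: "S \<in> A" and T: "T \<in> A"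
  shows "Re (cinner (\<iota> S) (\<iota> T)) = Re (\<tau> (adj T o\<^sub>L S))"
proof -
  note b = bounded[OF S] bounded[OF T]
  have "abs_sq (S + T) = abs_sq S + (adj T o\<^sub>L S) + (adj S o\<^sub>L T) + abs_sq T"
    by (simp add: abs_sq_def adj_add b compose_distrib)
  then have "Re (\<tau> (abs_sq (S + T))) =
      Re (\<tau> (abs_sq S)) + Re (\<tau> (adj T o\<^sub>L S)) + Re (\<tau> (adj S o\<^sub>L T)) + Re (\<tau> (abs_sq T))"
    using S T by (simp add: trace_add closed abs_sq_closed)
  moreover have "Re (\<tau> (adj S o\<^sub>L T)) = Re (\<tau> (adj T o\<^sub>L S))"
    using Re_trace_adj[of "adj T o\<^sub>L S"] S T by (simp add: adj_compose adj_adj b closed adj_in_bounded_ops)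
  moreover have "(norm (\<iota> S + \<iota> T))\<^sup>2 = Re (\<tau> (abs_sq (S + T)))"
    using S T by (simp add: norm_embed_sq closed flip: embed_add)
  ultimately show ?thesis
    using norm_add_sq[of "\<iota> S" "\<iota> T"] S T by (simp add: norm_embed_sq)
qed

lemma norm_embed_compose_le:
  assumes S: "S \<in> A" and T: "T \<in> A" and K: "norm S \<le> K"
  shows "norm (\<iota> (S o\<^sub>L T)) \<le> K * norm (\<iota> T)"
proof -
  have "0 \<le> K" using K norm_ge_zero order_trans by blast
  have "0 \<le> Re (\<tau> (op_scaleC (complex_of_real (K\<^sup>2)) (abs_sq T) - abs_sq (S o\<^sub>L T)))"
    using S T K by (intro trace_positive positive_norm_abs_sq) (auto simp: closed abs_sq_closed bounded)
  then have "(norm (\<iota> (S o\<^sub>L T)))\<^sup>2 \<le> (K * norm (\<iota> T))\<^sup>2"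
    using S T by (simp add: trace_diff trace_scaleC closed abs_sq_closed norm_embed_sq power_mult_distrib
        flip: of_real_power)
  then show ?thesis by (rule power2_le_imp_le) (simp add: \<open>0 \<le> K\<close>)
qed

text \<open>The identity has trace norm 1, so the operator norm dominates the trace norm.\<close>

lemma norm_embed_le:
  assumes T: "T \<in> A" and K: "norm T \<le> K"
  shows "norm (\<iota> T) \<le> K"
proof -
  have "(norm (\<iota> id_blinfun))\<^sup>2 = 1"
    by (simp add: norm_embed_sq closed abs_sq_def adj_id trace_id)
  then have "norm (\<iota> id_blinfun) = 1"
    by (metis norm_ge_zero one_power2 power2_eq_iff_nonneg zero_le_one)
  then show ?thesis using norm_embed_compose_le[OF T closed(2) K] by simp
qed

end

section \<open>Martingale transforms\<close>

text \<open>Recursion on the list replaces index arithmetic: sums over the intervals of a partition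
  become accessible to induction that removes the first time.\<close>

fun pair_sum :: "('a \<Rightarrow> 'a \<Rightarrow> 'b::comm_monoid_add) \<Rightarrow> 'a list \<Rightarrow> 'b" where
  "pair_sum f (a # b # l) = f a b + pair_sum f (b # l)"
| "pair_sum f _ = 0"

lemma sum_consecutive_eq_pair_sum:
  "(\<Sum>k\<in>{1..<length l}. f (l ! (k - 1)) (l ! k)) = pair_sum f l"
proof (induction f l rule: pair_sum.induct)
  case (1 f a b l)
  let ?g = "\<lambda>k. f ((a # b # l) ! (k - 1)) ((a # b # l) ! k)"
  have "sum ?g {1..<length (a # b # l)} = ?g 1 + sum ?g {Suc 1..<Suc (length (b # l))}"
    by (subst sum.atLeast_Suc_lessThan) simp_all
  also have "sum ?g {Suc 1..<Suc (length (b # l))} = (\<Sum>k\<in>{1..<length (b # l)}. ?g (Suc k))"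
    by (rule sum.shift_bounds_Suc_ivl)
  also have "\<dots> = (\<Sum>k\<in>{1..<length (b # l)}. f ((b # l) ! (k - 1)) ((b # l) ! k))"
    by (intro sum.cong) (auto simp: nth_Cons')
  finally show ?case using 1 by simp
qed simp_all

lemma pair_sum_mono:
  fixes f g :: "'a \<Rightarrow> 'a \<Rightarrow> real"
  assumes "sorted_wrt P l"
    and "\<And>a b. a \<in> set l \<Longrightarrow> b \<in> set l \<Longrightarrow> P a b \<Longrightarrow> f a b \<le> g a b"
  shows "pair_sum f l \<le> pair_sum g l"
  using assms
proof (induction f l rule: pair_sum.induct)
  case (1 f a b l)
  have "f a b \<le> g a b" using 1(2) by (intro 1(3)) simp_all
  moreover have "pair_sum f (b # l) \<le> pair_sum g (b # l)"
    using 1(2) by (intro 1(1) 1(3)) simp_all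
  ultimately show ?case by simp
qed simp_all

lemma pair_sum_add: "pair_sum (\<lambda>a b. f a b + g a b) l = pair_sum f l + pair_sum g l"
  by (induction f l rule: pair_sum.induct) (simp_all add: ac_simps)

lemma pair_sum_mult_left:
  "pair_sum (\<lambda>a b. c * f a b) l = c * pair_sum f l" for c :: "'b::semiring_0"
  by (induction f l rule: pair_sum.induct) (simp_all add: distrib_left)

lemma pair_sum_telescope:
  fixes X :: "'a \<Rightarrow> 'b::ab_group_add"
  shows "l \<noteq> [] \<Longrightarrow> pair_sum (\<lambda>a b. X b - X a) l = X (last l) - X (hd l)"
  by (induction "\<lambda>a b. X b - X a" l rule: pair_sum.induct) simp_all

lemma compose_pair_sum:
  "S o\<^sub>L pair_sum f l = pair_sum (\<lambda>a b. S o\<^sub>L f a b) l"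
  by (induction f l rule: pair_sum.induct) (simp_all add: compose_distrib)

locale martingale_L2 = tracial_L2 A \<tau> \<iota>
  for A :: "'h::complex_hilbert_space op set" and \<tau> and \<iota> :: "'h op \<Rightarrow> 'k::complex_hilbert_space" +
  fixes At :: "real \<Rightarrow> 'h op set"
    and E :: "real \<Rightarrow> 'h op \<Rightarrow> 'h op"
    and X :: "real \<Rightarrow> 'h op"
  assumes filtration: "filtration A At"
    and E: "\<And>s. s \<ge> 0 \<Longrightarrow> normal_conditional_expectation A (At s) (E s)"
    and trace_E: "\<And>s T. s \<ge> 0 \<Longrightarrow> T \<in> A \<Longrightarrow> \<tau> (E s T) = \<tau> T"
    and martingale: "martingale A E X"
begin

section \<open>Adaptedness and boundedness of the martingale\<close>

lemma filtration_vn: "0 \<le> s \<Longrightarrow> von_neumann_algebra (At s)"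
  and filtration_subset: "0 \<le> s \<Longrightarrow> At s \<subseteq> A"
  and filtration_mono: "0 \<le> s \<Longrightarrow> s \<le> t \<Longrightarrow> At s \<subseteq> At t"
  using filtration unfolding filtration_def by blast+

lemmas filtration_closed = von_neumann_algebra_closed[OF filtration_vn]

lemma X_closed: "0 \<le> s \<Longrightarrow> X s \<in> A"
  and E_X: "0 \<le> s \<Longrightarrow> s \<le> t \<Longrightarrow> E s (X t) = X s"
  using martingale by (simp_all add: martingale_def)

lemma X_adapted:
  assumes "0 \<le> s" "s \<le> t"
  shows "X s \<in> At t"
proof -
  have "E s (X s) \<in> At s"
    using E[of s] X_closed[of s] assms by (simp add: normal_conditional_expectation_def)
  then show ?thesis using E_X[of s s] filtration_mono[of s t] assms by auto
qed

text \<open>Conditional expectations are contractions, so \<open>norm (X t)\<close> bounds the whole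
  path up to time t.\<close>

lemma norm_X_le:
  assumes "0 \<le> s" "s \<le> t"
  shows "norm (X s) \<le> norm (X t)"
  using conditional_expectation_norm_le[OF vn filtration_vn filtration_subset E X_closed[of t]]
    E_X assms by (metis order_trans)

lemma increment_closed: "0 \<le> a \<Longrightarrow> 0 \<le> b \<Longrightarrow> X b - X a \<in> A"
  by (simp add: X_closed closed)

text \<open>The trace is invariant under \<open>E a\<close>, which is a module map over
  \<open>At a\<close>; hence S (X b) and S (X a) have the same trace.\<close>

lemma trace_increment:
  assumes a: "0 \<le> a" "a \<le> b" and S: "S \<in> At a"
  shows "\<tau> (S o\<^sub>L (X b - X a)) = 0"
proof -
  have SA: "S \<in> A" using S filtration_subset a by blast
  have mem: "X a \<in> A" "X b \<in> A" using a by (simp_all add: X_closed)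
  have "E a (S o\<^sub>L X b o\<^sub>L id_blinfun) = S o\<^sub>L E a (X b) o\<^sub>L id_blinfun"
    using E[OF a(1)] S mem filtration_closed(2)[OF a(1)]
    by (simp only: normal_conditional_expectation_def)
  then have "E a (S o\<^sub>L X b) = S o\<^sub>L X a" using a by (simp add: E_X)
  then have "\<tau> (S o\<^sub>L X b) = \<tau> (S o\<^sub>L X a)"
    using trace_E[OF a(1), of "S o\<^sub>L X b"] SA mem closed(4) by simp
  then show ?thesis using SA mem by (simp add: compose_distrib trace_diff closed)
qed

definition transform :: "(real \<Rightarrow> 'h op) \<Rightarrow> real list \<Rightarrow> 'h op" where
  "transform D = pair_sum (\<lambda>a b. D a o\<^sub>L (X b - X a))"

definition adapted_on :: "real list \<Rightarrow> (real \<Rightarrow> 'h op) \<Rightarrow> bool" where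
  "adapted_on l D \<longleftrightarrow> (\<forall>u\<in>set l. D u \<in> At u)"

text \<open>Tails of a partition no longer start at 0, so the inductions use this weaker condition,
  which passes to tails.\<close>

definition times :: "real list \<Rightarrow> bool" where
  "times l \<longleftrightarrow> sorted l \<and> (\<forall>u\<in>set l. 0 \<le> u)"

lemma pair_sum_closed:
  assumes "times l" "\<And>a b. a \<in> set l \<Longrightarrow> b \<in> set l \<Longrightarrow> f a b \<in> A"
  shows "pair_sum f l \<in> A"
  using assms
proof (induction f l rule: pair_sum.induct)
  case (1 f a b l)
  then show ?case by (auto simp: times_def intro!: closed)
qed (simp_all add: closed)

lemma transform_closed:
  assumes "times l" "adapted_on l D"
  shows "transform D l \<in> A"
  unfolding transform_def
proof (rule pair_sum_closed[OF assms(1)])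
  fix a b assume "a \<in> set l" "b \<in> set l"
  then show "D a o\<^sub>L (X b - X a) \<in> A"
    using assms filtration_subset[of a] by (auto simp: times_def adapted_on_def intro!: closed X_closed)
qed

text \<open>S belongs to \<open>At a\<close> for every a in the list, so S (D a) is an admissible
  left factor in \<open>trace_increment\<close> and each term vanishes.\<close>

lemma trace_compose_transform:
  assumes "times l" "adapted_on l D" "0 \<le> s" "\<forall>u\<in>set l. s \<le> u" "S \<in> At s"
  shows "\<tau> (S o\<^sub>L transform D l) = 0"
  using assms
proof (induction "\<lambda>a b. D a o\<^sub>L (X b - X a)" l rule: pair_sum.induct)
  case (1 a b l)
  have a: "0 \<le> a" "a \<le> b" and t: "times (b # l)" and ad: "adapted_on (b # l) D"
    using 1(2,3) by (auto simp: times_def adapted_on_def)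
  have Sa: "S \<in> At a" using filtration_mono[of s a] 1 by auto
  have Da: "D a \<in> At a" using 1(3) by (simp add: adapted_on_def)
  have SA: "S \<in> A" "D a \<in> A" using Sa Da filtration_subset[OF a(1)] by auto
  have m: "S o\<^sub>L (D a o\<^sub>L (X b - X a)) \<in> A" "S o\<^sub>L transform D (b # l) \<in> A"
    using SA a increment_closed[of a b] transform_closed[OF t ad] by (auto intro!: closed(4))
  have "transform D (a # b # l) = (D a o\<^sub>L (X b - X a)) + transform D (b # l)"
    by (simp add: transform_def)
  moreover have "\<tau> (S o\<^sub>L (D a o\<^sub>L (X b - X a))) = 0"
    using trace_increment[OF a filtration_closed(4)[OF a(1) Sa Da]] by (simp add: compose_assoc)
  moreover have "\<tau> (S o\<^sub>L transform D (b # l)) = 0"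
    using 1 t ad by (intro 1(1)) auto
  ultimately show ?case using m by (simp add: compose_distrib trace_add)
qed (simp_all add: transform_def trace_0)

text \<open>Pythagoras: the first term lies in \<open>At b\<close>, and the remaining transform
  starts at time b, so \<open>trace_compose_transform\<close> makes the two orthogonal.\<close>

lemma norm_transform_sq:
  assumes "times l" "adapted_on l D"
  shows "(norm (\<iota> (transform D l)))\<^sup>2 = pair_sum (\<lambda>a b. (norm (\<iota> (D a o\<^sub>L (X b - X a))))\<^sup>2) l"
  using assms
proof (induction "\<lambda>a b. D a o\<^sub>L (X b - X a)" l rule: pair_sum.induct)
  case (1 a b l)
  have a: "0 \<le> a" "a \<le> b" and t: "times (b # l)" and ad: "adapted_on (b # l) D"
    using 1(2,3) by (auto simp: times_def adapted_on_def)
  have b: "0 \<le> b" using a by simp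
  have Da: "D a \<in> At b" using 1(3) filtration_mono[of a b] a by (auto simp: adapted_on_def)
  have W: "D a o\<^sub>L (X b - X a) \<in> At b"
    using Da X_adapted a b by (intro filtration_closed(4) filtration_closed(7)) auto
  then have WA: "D a o\<^sub>L (X b - X a) \<in> A" using filtration_subset[OF b] by blast
  note TA = transform_closed[OF t ad]
  have "\<tau> (adj (D a o\<^sub>L (X b - X a)) o\<^sub>L transform D (b # l)) = 0"
    using t ad b W by (intro trace_compose_transform[where s = b]) (auto simp: times_def filtration_closed)
  then have orth: "Re (cinner (\<iota> (transform D (b # l))) (\<iota> (D a o\<^sub>L (X b - X a)))) = 0"
    by (simp add: Re_cinner_embed TA WA)
  have "transform D (a # b # l) = transform D (b # l) + (D a o\<^sub>L (X b - X a))"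
    by (simp add: transform_def)
  then have "(norm (\<iota> (transform D (a # b # l))))\<^sup>2 =
      (norm (\<iota> (transform D (b # l))))\<^sup>2 + (norm (\<iota> (D a o\<^sub>L (X b - X a))))\<^sup>2"
    by (simp add: embed_add TA WA norm_add_sq orth)
  then show ?case using 1(1)[OF t ad] by simp
qed (use embed_diff[of 0 0] closed in \<open>simp_all add: transform_def\<close>)

text \<open>A constant integrand known at the first time is adapted, and its transform telescopes;
  Pythagoras then evaluates the sum of squares.\<close>

lemma pair_sum_norm_compose_increment:
  assumes l: "times l" "l \<noteq> []" and Z: "Z \<in> At (hd l)"
  shows "pair_sum (\<lambda>a b. (norm (\<iota> (Z o\<^sub>L (X b - X a))))\<^sup>2) l =
    (norm (\<iota> (Z o\<^sub>L (X (last l) - X (hd l)))))\<^sup>2"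
proof -
  have "adapted_on l (\<lambda>_. Z)"
    unfolding adapted_on_def
  proof
    fix u assume "u \<in> set l"
    then have "hd l \<le> u" "0 \<le> hd l" using l by (cases l; auto simp: times_def)+
    then show "Z \<in> At u" using Z filtration_mono by blast
  qed
  note norm_transform_sq[OF l(1) this]
  moreover have "transform (\<lambda>_. Z) l = Z o\<^sub>L (X (last l) - X (hd l))"
    unfolding transform_def using pair_sum_telescope[OF l(2), of X]
    by (simp flip: compose_pair_sum)
  ultimately show ?thesis by simp
qed

lemma pair_sum_increment_sq_le:
  assumes l: "times l" and C: "\<And>u. u \<in> set l \<Longrightarrow> norm (X u) \<le> C"
  shows "pair_sum (\<lambda>a b. (norm (\<iota> (X b - X a)))\<^sup>2) l \<le> 4 * C\<^sup>2"
proof (cases "l = []")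
  case False
  then have hl: "hd l \<in> set l" "last l \<in> set l" by simp_all
  have pos: "0 \<le> hd l" "0 \<le> last l" using l hl by (auto simp: times_def)
  have "norm (X (last l) - X (hd l)) \<le> 2 * C"
    using norm_triangle_ineq4[of "X (last l)" "X (hd l)"] C[OF hl(1)] C[OF hl(2)] by simp
  then have "norm (\<iota> (X (last l) - X (hd l))) \<le> 2 * C"
    using pos by (intro norm_embed_le increment_closed)
  then have "(norm (\<iota> (X (last l) - X (hd l))))\<^sup>2 \<le> (2 * C)\<^sup>2"
    by (intro power_mono) simp_all
  then show ?thesis
    using pair_sum_norm_compose_increment[OF l False filtration_closed(2)[OF pos(1)]]
    by (simp add: power_mult_distrib)
qed simp

text \<open>The operator Q of the introduction. The factors stand in the order opposite to
  \<open>quad_sum\<close>, as required when an operator multiplies the increments from the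
  left.\<close>

definition adj_quad_sum :: "real list \<Rightarrow> 'h op" where
  "adj_quad_sum = pair_sum (\<lambda>a b. (X b - X a) o\<^sub>L adj (X b - X a))"

lemma adj_quad_sum_closed: "times l \<Longrightarrow> adj_quad_sum l \<in> A"
  unfolding adj_quad_sum_def
  by (rule pair_sum_closed) (auto simp: times_def intro!: closed X_closed)

text \<open>For an increment d, traciality moves d behind |W|^2 to form d (adj d); summing gives a
  trace that is linear in Q.\<close>

lemma pair_sum_compose_increment_sq:
  assumes "times l" "W \<in> A"
  shows "pair_sum (\<lambda>a b. (norm (\<iota> (W o\<^sub>L (X b - X a))))\<^sup>2) l =
    Re (\<tau> (abs_sq W o\<^sub>L adj_quad_sum l))"
  using assms
proof (induction "\<lambda>a b. W o\<^sub>L (X b - X a)" l rule: pair_sum.induct)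
  case (1 a b l)
  have t: "times (b # l)" and d: "X b - X a \<in> A"
    using 1(2) increment_closed[of a b] by (auto simp: times_def)
  note W = 1(3)
  define d where "d = X b - X a"
  have dA: "d \<in> A" using d by (simp add: d_def)
  have "(norm (\<iota> (W o\<^sub>L d)))\<^sup>2 = Re (\<tau> (adj d o\<^sub>L (abs_sq W o\<^sub>L d)))"
    using W dA by (simp add: norm_embed_sq closed abs_sq_def adj_compose bounded compose_assoc)
  also have "\<dots> = Re (\<tau> (abs_sq W o\<^sub>L (d o\<^sub>L adj d)))"
    using W dA by (simp add: trace_commute[of "adj d"] closed abs_sq_closed compose_assoc)
  finally have "(norm (\<iota> (W o\<^sub>L d)))\<^sup>2 = Re (\<tau> (abs_sq W o\<^sub>L (d o\<^sub>L adj d)))" .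
  moreover have "adj_quad_sum (a # b # l) = (d o\<^sub>L adj d) + adj_quad_sum (b # l)"
    by (simp add: adj_quad_sum_def d_def)
  moreover have "pair_sum (\<lambda>a b. (norm (\<iota> (W o\<^sub>L (X b - X a))))\<^sup>2) (a # b # l) =
      (norm (\<iota> (W o\<^sub>L d)))\<^sup>2 + pair_sum (\<lambda>a b. (norm (\<iota> (W o\<^sub>L (X b - X a))))\<^sup>2) (b # l)"
    by (simp add: d_def)
  ultimately show ?case
    using 1(1)[OF t W] W dA adj_quad_sum_closed[OF t]
    by (simp only: compose_distrib) (simp add: trace_add closed abs_sq_closed)
qed (simp_all add: adj_quad_sum_def trace_0)

text \<open>
  The mixed terms are computed without conditional expectations: with \<open>d\<close> the first increment and \<open>Q'\<close>
  the remaining sum, \<open>\<tau>(d d\<^sup>* Q') = \<Sum> \<parallel>d\<^sup>* \<Delta>X\<parallel>\<^sub>2\<^sup>2\<close>, which by orthogonality equals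
  \<open>\<parallel>d\<^sup>* r\<parallel>\<^sub>2\<^sup>2 = \<parallel>r\<^sup>* d\<parallel>\<^sub>2\<^sup>2\<close> for \<open>r\<close> the total remaining increment.
\<close>

lemma norm_adj_quad_sum_le_pair_sum:
  assumes "times l" "\<And>u. u \<in> set l \<Longrightarrow> norm (X u) \<le> C"
  shows "(norm (\<iota> (adj_quad_sum l)))\<^sup>2 \<le> 12 * C\<^sup>2 * pair_sum (\<lambda>a b. (norm (\<iota> (X b - X a)))\<^sup>2) l"
  using assms
proof (induction "\<lambda>a b. (norm (\<iota> (X b - X a)))\<^sup>2" l rule: pair_sum.induct)
  case (1 a b l)
  define d where "d = X b - X a"
  define q where "q = d o\<^sub>L adj d"
  define r where "r = X (last (b # l)) - X b"
  have a: "0 \<le> a" "0 \<le> b" "a \<le> b" "0 \<le> last (b # l)" and t: "times (b # l)"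
    using 1(2) by (auto simp: times_def)
  have le2: "norm (X v - X u) \<le> 2 * C" if "u \<in> set (a # b # l)" "v \<in> set (a # b # l)" for u v
    using norm_triangle_ineq4[of "X v" "X u"] 1(3)[OF that(1)] 1(3)[OF that(2)] by simp
  have mem: "d \<in> A" "q \<in> A" "r \<in> A"
    using a by (auto simp: d_def q_def r_def increment_closed closed simp del: last.simps)
  \<comment> \<open>The tail of the list starts at b, so \<open>adj d\<close> serves as a constant
    integrand there.\<close>
  have dAt: "adj d \<in> At b" using a X_adapted by (simp add: d_def filtration_closed)
  note bd = bounded[OF mem(1)] bounded[OF mem(3)]
  have nd: "norm d \<le> 2 * C" unfolding d_def by (rule le2) simp_all
  have nr: "norm (adj r) \<le> 2 * C"
    unfolding norm_adj[OF bd(2)] unfolding r_def by (rule le2) simp_all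
  have "norm (\<iota> q) \<le> 2 * C * norm (\<iota> d)"
    using norm_embed_compose_le[OF mem(1) closed(3)[OF mem(1)] nd] mem by (simp add: q_def norm_embed_adj)
  then have q: "(norm (\<iota> q))\<^sup>2 \<le> 4 * C\<^sup>2 * (norm (\<iota> d))\<^sup>2"
    using power_mono[of "norm (\<iota> q)" "2 * C * norm (\<iota> d)" 2] by (simp add: power_mult_distrib)
  note Q = adj_quad_sum_closed[OF t]
  have "Re (cinner (\<iota> (adj_quad_sum (b # l))) (\<iota> q)) = Re (\<tau> (abs_sq (adj d) o\<^sub>L adj_quad_sum (b # l)))"
    using mem Q bd by (simp add: Re_cinner_embed q_def adj_compose adj_in_bounded_ops adj_adj abs_sq_def)
  also have "\<dots> = pair_sum (\<lambda>u v. (norm (\<iota> (adj d o\<^sub>L (X v - X u))))\<^sup>2) (b # l)"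
    using pair_sum_compose_increment_sq[OF t closed(3)[OF mem(1)]] by simp
  also have "\<dots> = (norm (\<iota> (adj d o\<^sub>L r)))\<^sup>2"
    using pair_sum_norm_compose_increment[OF t _, of "adj d"] dAt by (simp add: r_def)
  \<comment> \<open>Taking adjoints puts r on the left, where its operator norm is used, and keeps
    the trace norm of d, whose squares have a bounded sum.\<close>
  also have "\<dots> = (norm (\<iota> (adj r o\<^sub>L d)))\<^sup>2"
    using norm_embed_adj[of "adj d o\<^sub>L r"] mem bd by (simp add: adj_compose adj_in_bounded_ops adj_adj closed)
  also have "\<dots> \<le> (2 * C * norm (\<iota> d))\<^sup>2"
    using norm_embed_compose_le[OF closed(3)[OF mem(3)] mem(1) nr] by (intro power_mono) simp_all
  finally have cross: "Re (cinner (\<iota> (adj_quad_sum (b # l))) (\<iota> q)) \<le> 4 * C\<^sup>2 * (norm (\<iota> d))\<^sup>2"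
    by (simp add: power_mult_distrib)
  have "adj_quad_sum (a # b # l) = adj_quad_sum (b # l) + q"
    by (simp add: adj_quad_sum_def q_def d_def)
  then have "(norm (\<iota> (adj_quad_sum (a # b # l))))\<^sup>2 =
      (norm (\<iota> (adj_quad_sum (b # l))))\<^sup>2 + 2 * Re (cinner (\<iota> (adj_quad_sum (b # l))) (\<iota> q)) +
      (norm (\<iota> q))\<^sup>2"
    using mem Q by (simp add: embed_add norm_add_sq)
  \<comment> \<open>The constant is 12 = 4 + 2 * 4: one 4 from q and twice 4 from the cross
    term.\<close>
  also have "\<dots> \<le> 12 * C\<^sup>2 * pair_sum (\<lambda>a b. (norm (\<iota> (X b - X a)))\<^sup>2) (b # l) +
      12 * C\<^sup>2 * (norm (\<iota> d))\<^sup>2"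
    using q cross 1(1)[OF t] 1(3) by simp
  finally show ?case by (simp add: d_def distrib_left)
qed (use embed_diff[of 0 0] closed in \<open>simp_all add: adj_quad_sum_def\<close>)

lemma norm_adj_quad_sum_le:
  assumes l: "times l" and C: "\<And>u. u \<in> set l \<Longrightarrow> norm (X u) \<le> C"
  shows "norm (\<iota> (adj_quad_sum l)) \<le> 7 * C\<^sup>2"
proof -
  have "(norm (\<iota> (adj_quad_sum l)))\<^sup>2 \<le> 12 * C\<^sup>2 * (4 * C\<^sup>2)"
    using norm_adj_quad_sum_le_pair_sum[OF l C] pair_sum_increment_sq_le[OF l C]
    by (meson mult_left_mono order_trans zero_le_mult_iff zero_le_numeral zero_le_power2)
  also have "\<dots> = 48 * (C\<^sup>2)\<^sup>2" by (simp add: power2_eq_square)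
  \<comment> \<open>48 is rounded up to the square 49.\<close>
  also have "\<dots> \<le> (7 * C\<^sup>2)\<^sup>2" by (simp only: power_mult_distrib) simp
  finally show ?thesis by (rule power2_le_imp_le) simp
qed

text \<open>With p = 1 - e, each term splits as (D e) \<Delta>X + D (p \<Delta>X). The first part is
  controlled by \<eta> and the bounded sum of squared increments, the second by K and the trace of p
  Q.\<close>

lemma norm_transform_le:
  assumes l: "times l" and C: "\<And>u. u \<in> set l \<Longrightarrow> norm (X u) \<le> C"
    and D: "adapted_on l D" and K: "\<And>u. u \<in> set l \<Longrightarrow> norm (D u) \<le> K"
    and e: "e \<in> projections A" "Re (\<tau> e) \<ge> 1 - \<epsilon>"
    and \<eta>: "\<And>u. u \<in> set l \<Longrightarrow> norm (D u o\<^sub>L e) \<le> \<eta>"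
  shows "(norm (\<iota> (transform D l)))\<^sup>2 \<le> 8 * \<eta>\<^sup>2 * C\<^sup>2 + 14 * K\<^sup>2 * C\<^sup>2 * sqrt \<epsilon>"
proof -
  define p where "p = id_blinfun - e"
  have eA: "e \<in> A" "adj e = e" "e o\<^sub>L e = e" using e by (auto simp: projections_def)
  have pA: "p \<in> A" using eA closed by (simp add: p_def)
  have "adj p = p" using eA by (simp add: p_def adj_diff adj_id bounded closed)
  moreover have "p o\<^sub>L p = p" by (simp add: p_def compose_distrib eA)
  ultimately have p: "abs_sq p = p" "adj p = p" by (simp_all add: abs_sq_def)
  \<comment> \<open>p is a projection, so its squared trace norm is its trace, 1 minus the trace of
    e.\<close>
  have "(norm (\<iota> p))\<^sup>2 \<le> \<epsilon>"
    using e by (simp add: norm_embed_sq pA p) (simp add: p_def trace_diff closed eA trace_id)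
  then have np: "norm (\<iota> p) \<le> sqrt \<epsilon>" by (rule real_le_rsqrt)
  define V where "V = pair_sum (\<lambda>a b. (norm (\<iota> (X b - X a)))\<^sup>2) l"
  define W where "W = pair_sum (\<lambda>a b. (norm (\<iota> (p o\<^sub>L (X b - X a))))\<^sup>2) l"
  have V: "V \<le> 4 * C\<^sup>2" unfolding V_def by (rule pair_sum_increment_sq_le[OF l C])
  have "W = Re (cinner (\<iota> (adj_quad_sum l)) (\<iota> p))"
    using pair_sum_compose_increment_sq[OF l pA]
    by (simp add: W_def Re_cinner_embed adj_quad_sum_closed[OF l] pA p)
  also have "\<dots> \<le> norm (\<iota> (adj_quad_sum l)) * norm (\<iota> p)"
    using cinner_cauchy_schwarz complex_Re_le_cmod order_trans by blast
  also have "\<dots> \<le> 7 * C\<^sup>2 * sqrt \<epsilon>"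
    using norm_adj_quad_sum_le[OF l C] np by (intro mult_mono) simp_all
  finally have W: "W \<le> 7 * C\<^sup>2 * sqrt \<epsilon>" .
  have "(norm (\<iota> (transform D l)))\<^sup>2 = pair_sum (\<lambda>a b. (norm (\<iota> (D a o\<^sub>L (X b - X a))))\<^sup>2) l"
    by (rule norm_transform_sq[OF l D])
  also have "\<dots> \<le> pair_sum (\<lambda>a b. 2 * \<eta>\<^sup>2 * (norm (\<iota> (X b - X a)))\<^sup>2 +
      2 * K\<^sup>2 * (norm (\<iota> (p o\<^sub>L (X b - X a))))\<^sup>2) l"
  proof (rule pair_sum_mono)
    show "sorted_wrt (\<le>) l" using l by (simp add: times_def)
    fix a b assume ab: "a \<in> set l" "b \<in> set l" "a \<le> b"
    define d where "d = X b - X a"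
    have pos: "0 \<le> a" "0 \<le> b" using ab l by (auto simp: times_def)
    then have mem: "d \<in> A" "D a \<in> A"
      using ab D filtration_subset[of a] by (auto simp: d_def adapted_on_def increment_closed)
    have split: "D a o\<^sub>L d = ((D a o\<^sub>L e) o\<^sub>L d) + (D a o\<^sub>L (p o\<^sub>L d))"
      by (simp add: p_def compose_distrib compose_assoc)
    have 1: "norm (\<iota> ((D a o\<^sub>L e) o\<^sub>L d)) \<le> \<eta> * norm (\<iota> d)"
      using mem eA \<eta>[OF ab(1)] by (intro norm_embed_compose_le closed)
    have 2: "norm (\<iota> (D a o\<^sub>L (p o\<^sub>L d))) \<le> K * norm (\<iota> (p o\<^sub>L d))"
      using mem pA K[OF ab(1)] by (intro norm_embed_compose_le closed)
    have "norm (\<iota> (D a o\<^sub>L d)) \<le> norm (\<iota> ((D a o\<^sub>L e) o\<^sub>L d)) + norm (\<iota> (D a o\<^sub>L (p o\<^sub>L d)))"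
      using mem eA pA unfolding split by (simp add: embed_add closed norm_triangle_ineq)
    also have "\<dots> \<le> \<eta> * norm (\<iota> d) + K * norm (\<iota> (p o\<^sub>L d))"
      using 1 2 by simp
    finally have "(norm (\<iota> (D a o\<^sub>L d)))\<^sup>2 \<le> (\<eta> * norm (\<iota> d) + K * norm (\<iota> (p o\<^sub>L d)))\<^sup>2"
      by (intro power_mono) simp_all
    \<comment> \<open>(x + y)^2 \<le> 2 x^2 + 2 y^2; this factor 2 turns the constants 4 and 7 into
      8 and 14.\<close>
    also have "\<dots> \<le> 2 * (\<eta> * norm (\<iota> d))\<^sup>2 + 2 * (K * norm (\<iota> (p o\<^sub>L d)))\<^sup>2"
      using sum_squares_bound[of "\<eta> * norm (\<iota> d)" "K * norm (\<iota> (p o\<^sub>L d))"]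
      by (simp add: power2_sum)
    finally show "(norm (\<iota> (D a o\<^sub>L (X b - X a))))\<^sup>2 \<le> 2 * \<eta>\<^sup>2 * (norm (\<iota> (X b - X a)))\<^sup>2 +
      2 * K\<^sup>2 * (norm (\<iota> (p o\<^sub>L (X b - X a))))\<^sup>2"
      by (simp add: d_def power_mult_distrib)
  qed
  also have "\<dots> = 2 * \<eta>\<^sup>2 * V + 2 * K\<^sup>2 * W"
    by (simp add: pair_sum_add pair_sum_mult_left V_def W_def)
  also have "\<dots> \<le> 2 * \<eta>\<^sup>2 * (4 * C\<^sup>2) + 2 * K\<^sup>2 * (7 * C\<^sup>2 * sqrt \<epsilon>)"
    using V W by (intro add_mono mult_left_mono) simp_all
  finally show ?thesis by (simp add: mult_ac)
qed

end

section \<open>Refinement of partitions\<close>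

lemma pair_sum_cong:
  "(\<And>a b. a \<in> set l \<Longrightarrow> b \<in> set l \<Longrightarrow> f a b = g a b) \<Longrightarrow> pair_sum f l = pair_sum g l"
  by (induction f l rule: pair_sum.induct) simp_all

lemma pair_sum_diff:
  "pair_sum (\<lambda>a b. f a b - g a b) l = pair_sum f l - pair_sum g l" for f :: "'a \<Rightarrow> 'a \<Rightarrow> 'b::ab_group_add"
  by (induction f l rule: pair_sum.induct) simp_all

text \<open>The integrand g is constant along the points of l' between consecutive points of l, so
  the finer increments regroup by telescoping. The induction consumes the finer list l'.\<close>

lemma pair_sum_refine:
  fixes g X :: "'a::linorder \<Rightarrow> 'h::real_normed_vector \<Rightarrow>\<^sub>L 'h"
  assumes "sorted_wrt (<) l'" "sorted_wrt (<) l" "set l \<subseteq> set l'" "l \<noteq> []"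
    and "hd l = hd l'" "last l = last l'"
    and "\<And>u v. u \<in> set l' \<Longrightarrow> v \<in> set l' \<Longrightarrow> u \<le> v \<Longrightarrow> set l \<inter> {u<..v} = {} \<Longrightarrow> g u = g v"
  shows "pair_sum (\<lambda>a b. g a o\<^sub>L (X b - X a)) l = pair_sum (\<lambda>a b. g a o\<^sub>L (X b - X a)) l'"
  using assms
proof (induction "\<lambda>a b. g a o\<^sub>L (X b - X a)" l' arbitrary: l rule: pair_sum.induct)
  case (1 a b m)
  let ?f = "\<lambda>a b. g a o\<^sub>L (X b - X a)"
  obtain l2 where l2: "l = a # l2" using 1 by (cases l) auto
  have "l2 \<noteq> []"
  proof
    assume "l2 = []"
    then have "last (b # m) = a" using 1(7) l2 by simp
    then show False using 1(2) last_in_set[of "b # m"] by auto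
  qed
  then obtain c n where l: "l = a # c # n" using l2 by (cases l2) auto
  have sub: "set (c # n) \<subseteq> set (b # m)" using 1(2-4) l by auto
  then have bc: "b \<le> c" using 1(2) by (auto intro: less_imp_le)
  show ?case
  proof (cases "b = c")
    case True
    have "pair_sum ?f (c # n) = pair_sum ?f (b # m)"
    proof (rule 1(1))
      fix u v assume uv: "u \<in> set (b # m)" "v \<in> set (b # m)" "u \<le> v" "set (c # n) \<inter> {u<..v} = {}"
      have "a < u" using 1(2) uv by auto
      then have "set l \<inter> {u<..v} = {}" using uv l by auto
      then show "g u = g v" using 1(8) uv by simp
    qed (use 1 l sub True in auto)
    then show ?thesis using l True by simp
  next
    case False
    then have bc: "b < c" using bc by simp
    have bn: "\<forall>x\<in>set n. b < x" using 1(3) l bc by (auto intro: less_trans)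
    \<comment> \<open>When b is not in l, the induction hypothesis is applied to l with its first
      point moved from a to b.\<close>
    have "pair_sum ?f (b # c # n) = pair_sum ?f (b # m)"
    proof (rule 1(1))
      fix u v assume uv: "u \<in> set (b # m)" "v \<in> set (b # m)" "u \<le> v" "set (b # c # n) \<inter> {u<..v} = {}"
      have "a < u" using 1(2) uv by auto
      then have "set l \<inter> {u<..v} = {}" using uv l by auto
      then show "g u = g v" using 1(8) uv by simp
    qed (use 1 l sub bc bn in auto)
    moreover have "g a = g b"
    proof (rule 1(8))
      show "set l \<inter> {a<..b} = {}" using l 1(3) bc by auto
      show "a \<le> b" using 1(2) by auto
    qed simp_all
    then have "?f a c = ?f a b + ?f b c" by (simp add: compose_distrib)
    ultimately show ?thesis using l by (simp add: add.assoc)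
  qed
next
  case ("2_2" a)
  then obtain l2 where "l = a # l2" by (cases l) auto
  moreover from this have "l2 = []" using "2_2" by (cases l2) auto
  ultimately show ?case by simp
qed simp

text \<open>This extends evaluation at left partition points to a step function of time, so that
  Riemann sums over different partitions can be compared on one refinement.\<close>

definition last_before :: "real list \<Rightarrow> real \<Rightarrow> real" where
  "last_before \<theta> u = Max {p \<in> set \<theta>. p \<le> u}"

section \<open>Partitions, mesh and common refinements\<close>

lemma partitions_iff: "\<theta> \<in> partitions t \<longleftrightarrow> \<theta> \<noteq> [] \<and> sorted_wrt (<) \<theta> \<and> hd \<theta> = 0 \<and> last \<theta> = t"
  by (simp add: partitions_def)

lemma partition_range:
  assumes "\<theta> \<in> partitions t" "u \<in> set \<theta>"
  shows "0 \<le> u" "u \<le> t"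
proof -
  have s: "sorted_wrt (<) \<theta>" "\<theta> \<noteq> []" "hd \<theta> = 0" "last \<theta> = t" using assms by (simp_all add: partitions_iff)
  obtain i where i: "i < length \<theta>" "u = \<theta> ! i" using assms(2) by (metis in_set_conv_nth)
  have le: "\<theta> ! j \<le> \<theta> ! k" if "j \<le> k" "k < length \<theta>" for j k
    using sorted_wrt_nth_less[OF s(1), of j k] that by (cases "j = k") auto
  show "0 \<le> u" using le[of 0 i] i s by (simp add: hd_conv_nth)
  show "u \<le> t" using le[of i "length \<theta> - 1"] i s by (simp add: last_conv_nth)
qed

lemma last_before:
  assumes "\<theta> \<in> partitions t" "0 \<le> u"
  shows "last_before \<theta> u \<in> set \<theta>" "last_before \<theta> u \<le> u"
    and "\<And>p. p \<in> set \<theta> \<Longrightarrow> p \<le> u \<Longrightarrow> p \<le> last_before \<theta> u"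
proof -
  let ?S = "{p \<in> set \<theta>. p \<le> u}"
  have "hd \<theta> \<in> ?S" using assms hd_in_set[of \<theta>] by (simp add: partitions_iff)
  then have "finite ?S" "?S \<noteq> {}" by auto
  then have "last_before \<theta> u \<in> ?S" unfolding last_before_def by (rule Max_in)
  then show "last_before \<theta> u \<in> set \<theta>" "last_before \<theta> u \<le> u" by auto
  show "p \<le> last_before \<theta> u" if "p \<in> set \<theta>" "p \<le> u" for p
    unfolding last_before_def using that by (intro Max_ge) auto
qed

lemma last_before_self:
  assumes "\<theta> \<in> partitions t" "u \<in> set \<theta>"
  shows "last_before \<theta> u = u"
  using last_before(2,3)[OF assms(1) partition_range(1)[OF assms]] assms(2) by (simp add: antisym)

lemma mesh_nonneg: "0 \<le> mesh \<theta>"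
  unfolding mesh_def by (intro Max_ge) auto

text \<open>The next partition point lies beyond u. If there is none, the last point before u is t,
  and the difference is at most 0.\<close>

lemma diff_last_before_le_mesh:
  assumes \<theta>: "\<theta> \<in> partitions t" and u: "0 \<le> u" "u \<le> t"
  shows "u - last_before \<theta> u \<le> mesh \<theta>"
proof -
  have s: "sorted_wrt (<) \<theta>" "\<theta> \<noteq> []" "last \<theta> = t" using \<theta> by (simp_all add: partitions_iff)
  obtain k where k: "k < length \<theta>" "last_before \<theta> u = \<theta> ! k"
    using last_before(1)[OF \<theta> u(1)] by (metis in_set_conv_nth)
  show ?thesis
  proof (cases "Suc k < length \<theta>")
    case True
    have "\<theta> ! k < \<theta> ! Suc k" using sorted_wrt_nth_less[OF s(1)] True by simp
    then have "u < \<theta> ! Suc k"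
      using last_before(3)[OF \<theta> u(1), of "\<theta> ! Suc k"] True k by force
    moreover have "\<theta> ! Suc k - \<theta> ! (Suc k - 1) \<le> mesh \<theta>"
      unfolding mesh_def using True by (intro Max_ge insertI2 imageI) auto
    ultimately show ?thesis using k by simp
  next
    case False
    then have "k = length \<theta> - 1" using k by simp
    then have "last_before \<theta> u = t" using k s by (simp add: last_conv_nth)
    then show ?thesis using u mesh_nonneg[of \<theta>] by simp
  qed
qed

lemma common_refinement:
  assumes "\<theta> \<in> partitions t" "\<theta>' \<in> partitions t"
  shows "sorted_list_of_set (set \<theta> \<union> set \<theta>') \<in> partitions t"
proof -
  let ?l = "sorted_list_of_set (set \<theta> \<union> set \<theta>')"
  have set: "set ?l = set \<theta> \<union> set \<theta>'" by simp
  have s: "sorted_wrt (<) ?l" by (rule strict_sorted_list_of_set)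
  have ends: "0 \<in> set ?l" "t \<in> set ?l"
    using assms hd_in_set[of \<theta>] last_in_set[of \<theta>] unfolding set by (auto simp: partitions_iff)
  have ne: "?l \<noteq> []" using ends by fastforce
  have range: "0 \<le> u" "u \<le> t" if "u \<in> set ?l" for u
    using that partition_range[OF assms(1)] partition_range[OF assms(2)] unfolding set by auto
  have sorted: "sorted ?l" by simp
  have "hd ?l \<le> 0" using ends(1) sorted ne by (cases ?l) auto
  then have "hd ?l = 0" using range(1)[of "hd ?l"] ne hd_in_set by (metis antisym)
  moreover have "t \<le> last ?l"
  proof -
    obtain i where "i < length ?l" "t = ?l ! i" using ends(2) by (metis in_set_conv_nth)
    then show ?thesis using sorted_nth_mono[OF sorted, of i "length ?l - 1"] ne by (simp add: last_conv_nth)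
  qed
  then have "last ?l = t" using range(2)[of "last ?l"] ne last_in_set by (metis antisym)
  ultimately show ?thesis using s ne by (simp add: partitions_iff)
qed

text \<open>Equidistant partitions with more than t/\<delta> intervals have mesh below \<delta>.
  Nontriviality of the filter makes limits unique, so that \<open>Lim\<close> returns them.\<close>

lemma mesh_to_0_neq_bot:
  assumes "0 \<le> t"
  shows "mesh_to_0 t \<noteq> bot"
proof -
  have "\<exists>\<theta>\<in>partitions t. mesh \<theta> < \<delta>" if \<delta>: "\<delta> > 0" for \<delta>
  proof (cases "t = 0")
    case True
    then show ?thesis using \<delta> by (intro bexI[of _ "[0]"]) (simp_all add: mesh_def partitions_iff)
  next
    case False
    then have t: "t > 0" using assms by simp
    obtain n where n: "t / \<delta> < real n" using reals_Archimedean2 by blast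
    have n0: "0 < real n" using n t \<delta> by (meson divide_pos_pos less_trans)
    define \<theta> where "\<theta> = map (\<lambda>k. t * real k / real n) [0..<Suc n]"
    have "sorted_wrt (<) \<theta>"
      unfolding \<theta>_def sorted_wrt_map
      by (rule sorted_wrt_mono_rel[OF _ sorted_wrt_upt]) (use t n0 in \<open>simp add: divide_strict_right_mono\<close>)
    moreover have "hd \<theta> = 0" "last \<theta> = t" "\<theta> \<noteq> []"
      using n0 by (simp_all add: \<theta>_def hd_map last_map del: upt_Suc)
    ultimately have "\<theta> \<in> partitions t" by (simp add: partitions_iff)
    moreover have "mesh \<theta> < \<delta>"
    proof -
      have "\<theta> ! k - \<theta> ! (k - 1) < \<delta>" if k: "k \<in> {1..<length \<theta>}" for k
      proof -
        have "\<theta> ! k = t * real k / real n" "\<theta> ! (k - 1) = t * real (k - 1) / real n"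
          using k by (auto simp: \<theta>_def nth_append simp del: upt_Suc)
        then have "\<theta> ! k - \<theta> ! (k - 1) = t / real n"
          using k by (simp add: of_nat_diff diff_divide_distrib[symmetric] right_diff_distrib)
        also have "\<dots> < \<delta>" using n n0 \<delta> by (simp add: field_simps)
        finally show ?thesis .
      qed
      then show ?thesis unfolding mesh_def using \<delta> by (subst Max_less_iff) auto
    qed
    ultimately show ?thesis by blast
  qed
  then have "\<not> eventually (\<lambda>_. False) (mesh_to_0 t)"
    unfolding eventually_mesh_to_0 by blast
  then show ?thesis by (simp add: trivial_limit_def)
qed

section \<open>Riemann sums and their limits along the mesh\<close>

lemma right_sum_eq_pair_sum: "right_sum Y X = pair_sum (\<lambda>a b. Y a o\<^sub>L (X b - X a))"
  unfolding right_sum_def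
  by (rule ext) (rule sum_consecutive_eq_pair_sum[where f = "\<lambda>a b. Y a o\<^sub>L (X b - X a)"])

lemma left_sum_eq_pair_sum: "left_sum X Y = pair_sum (\<lambda>a b. (X b - X a) o\<^sub>L Y a)"
  unfolding left_sum_def
  by (rule ext) (rule sum_consecutive_eq_pair_sum[where f = "\<lambda>a b. (X b - X a) o\<^sub>L Y a"])

lemma quad_sum_eq_pair_sum: "quad_sum X = pair_sum (\<lambda>a b. abs_sq (X b - X a))"
  unfolding quad_sum_def
  by (rule ext) (rule sum_consecutive_eq_pair_sum[where f = "\<lambda>a b. abs_sq (X b - X a)"])

lemma right_sum_last_before:
  assumes \<theta>: "\<theta> \<in> partitions t" and l: "l \<in> partitions t" and sub: "set \<theta> \<subseteq> set l"
  shows "right_sum Y X \<theta> = right_sum (\<lambda>u. Y (last_before \<theta> u)) X l"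
proof -
  have "right_sum Y X \<theta> = right_sum (\<lambda>u. Y (last_before \<theta> u)) X \<theta>"
    unfolding right_sum_eq_pair_sum by (rule pair_sum_cong) (simp add: last_before_self[OF \<theta>])
  also have "\<dots> = right_sum (\<lambda>u. Y (last_before \<theta> u)) X l"
    unfolding right_sum_eq_pair_sum
  proof (rule pair_sum_refine)
    fix u v :: real assume "u \<le> v" "set \<theta> \<inter> {u<..v} = {}"
    then have "{p \<in> set \<theta>. p \<le> u} = {p \<in> set \<theta>. p \<le> v}" by (auto simp: disjoint_iff not_le)
    then show "Y (last_before \<theta> u) = Y (last_before \<theta> v)" by (simp add: last_before_def)
  qed (use assms in \<open>auto simp: partitions_iff\<close>)
  finally show ?thesis .
qed

text \<open>Completeness yields a limit of the Cauchy filter. The conclusion names it by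
  \<open>Lim\<close> because the integrals are defined that way.\<close>

lemma convergent_if_Cauchy_mesh:
  fixes f :: "real list \<Rightarrow> 'k::banach"
  assumes t: "0 \<le> t"
    and "\<And>\<epsilon>. \<epsilon> > 0 \<Longrightarrow> \<exists>\<delta>>0. \<forall>\<theta>\<in>partitions t. \<forall>\<theta>'\<in>partitions t.
      mesh \<theta> < \<delta> \<longrightarrow> mesh \<theta>' < \<delta> \<longrightarrow> norm (f \<theta> - f \<theta>') < \<epsilon>"
  shows "(f \<longlongrightarrow> Lim (mesh_to_0 t) f) (mesh_to_0 t)"
proof -
  have "cauchy_filter (filtermap f (mesh_to_0 t))"
    unfolding cauchy_filter_metric_filtermap
  proof (intro allI impI)
    fix e :: real assume "e > 0"
    then obtain \<delta> where "\<delta> > 0" and \<delta>: "\<forall>\<theta>\<in>partitions t. \<forall>\<theta>'\<in>partitions t.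
        mesh \<theta> < \<delta> \<longrightarrow> mesh \<theta>' < \<delta> \<longrightarrow> norm (f \<theta> - f \<theta>') < e"
      using assms(2) by blast
    then show "\<exists>P. eventually P (mesh_to_0 t) \<and> (\<forall>x y. P x \<and> P y \<longrightarrow> dist (f x) (f y) < e)"
      by (intro exI[of _ "\<lambda>\<theta>. \<theta> \<in> partitions t \<and> mesh \<theta> < \<delta>"])
         (auto simp: eventually_mesh_to_0 dist_norm)
  qed
  moreover have "complete (UNIV :: 'k set)"
    by (meson Cauchy_convergent UNIV_I complete_def convergent_def)
  moreover have "filtermap f (mesh_to_0 t) \<noteq> bot"
    using mesh_to_0_neq_bot[OF t] by (simp add: filtermap_bot_iff)
  ultimately obtain c where "filtermap f (mesh_to_0 t) \<le> nhds c"
    using cauchy_filter_complete_converges[of "filtermap f (mesh_to_0 t)" UNIV] by auto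
  then have "(f \<longlongrightarrow> c) (mesh_to_0 t)" by (simp add: filterlim_def)
  then show ?thesis using tendsto_Lim[OF mesh_to_0_neq_bot[OF t]] by metis
qed

section \<open>Existence of the integrals and quadratic variation\<close>

context martingale_L2
begin

lemma partition_times: "\<theta> \<in> partitions t \<Longrightarrow> times \<theta>"
  using partition_range by (auto simp: times_def partitions_iff strict_sorted_iff)

lemma right_sum_closed: "\<theta> \<in> partitions t \<Longrightarrow> right_sum (\<lambda>u. adj (X u)) X \<theta> \<in> A"
  unfolding right_sum_eq_pair_sum
  by (rule pair_sum_closed[OF partition_times]) (auto dest: partition_range intro!: closed X_closed)

text \<open>On the common refinement, the difference is the transform of D, the difference of
  adjoints of X at the two preceding partition points. Since D e is the adjoint of e (X r - X s),
  Segal's condition (L) bounds it.\<close>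

lemma norm_right_sum_diff_le:
  assumes \<theta>: "\<theta> \<in> partitions t" "\<theta>' \<in> partitions t"
    and e: "e \<in> projections A" "Re (\<tau> e) \<ge> 1 - \<epsilon>"
    and small: "\<And>r s. r \<in> {0..t} \<Longrightarrow> s \<in> {0..t} \<Longrightarrow> \<bar>r - s\<bar> < \<delta> \<Longrightarrow> norm (e o\<^sub>L (X r - X s)) \<le> \<eta>"
    and mesh: "mesh \<theta> < \<delta>" "mesh \<theta>' < \<delta>"
  defines "C \<equiv> norm (X t)"
  shows "(norm (\<iota> (right_sum (\<lambda>u. adj (X u)) X \<theta>) - \<iota> (right_sum (\<lambda>u. adj (X u)) X \<theta>')))\<^sup>2 \<le>
    8 * \<eta>\<^sup>2 * C\<^sup>2 + 56 * (C\<^sup>2)\<^sup>2 * sqrt \<epsilon>"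
proof -
  define l where "l = sorted_list_of_set (set \<theta> \<union> set \<theta>')"
  have l: "l \<in> partitions t" unfolding l_def by (rule common_refinement[OF \<theta>])
  have sub: "set \<theta> \<subseteq> set l" "set \<theta>' \<subseteq> set l" by (simp_all add: l_def)
  let ?r = "last_before \<theta>" and ?s = "last_before \<theta>'"
  define D where "D u = adj (X (?r u)) - adj (X (?s u))" for u
  have C: "norm (X u) \<le> C" if "0 \<le> u" "u \<le> t" for u
    unfolding C_def using norm_X_le that by simp
  have u: "0 \<le> ?r u" "?r u \<le> u" "0 \<le> ?s u" "?s u \<le> u" "u \<le> t" "\<bar>?r u - ?s u\<bar> < \<delta>"
    if "u \<in> set l" for u
  proof -
    note ul = partition_range[OF l that]
    show "?r u \<le> u" "?s u \<le> u" "u \<le> t" using last_before(2)[OF \<theta>(1) ul(1)] last_before(2)[OF \<theta>(2) ul(1)] ul by auto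
    \<comment> \<open>Both points lie between u - \<delta> and u.\<close>
    then show "\<bar>?r u - ?s u\<bar> < \<delta>"
      using diff_last_before_le_mesh[OF \<theta>(1) ul] diff_last_before_le_mesh[OF \<theta>(2) ul] mesh by linarith
    show "0 \<le> ?r u" "0 \<le> ?s u"
      using last_before(1)[OF \<theta>(1) ul(1)] last_before(1)[OF \<theta>(2) ul(1)] partition_range \<theta> by blast+
  qed
  have "right_sum (\<lambda>u. adj (X u)) X \<theta> - right_sum (\<lambda>u. adj (X u)) X \<theta>' = transform D l"
    unfolding right_sum_last_before[OF \<theta>(1) l sub(1)] right_sum_last_before[OF \<theta>(2) l sub(2)]
    unfolding right_sum_eq_pair_sum transform_def pair_sum_diff[symmetric]
    by (rule pair_sum_cong) (simp add: D_def bounded_bilinear.diff_left[OF bounded_bilinear_blinfun_compose])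
  then have "\<iota> (right_sum (\<lambda>u. adj (X u)) X \<theta>) - \<iota> (right_sum (\<lambda>u. adj (X u)) X \<theta>') = \<iota> (transform D l)"
    using \<theta> by (simp add: right_sum_closed flip: embed_diff)
  \<comment> \<open>The bound K for the integrand is 2 C, by the triangle inequality, which produces
    14 * 4 = 56.\<close>
  moreover have "(norm (\<iota> (transform D l)))\<^sup>2 \<le> 8 * \<eta>\<^sup>2 * C\<^sup>2 + 14 * (2 * C)\<^sup>2 * C\<^sup>2 * sqrt \<epsilon>"
  proof (rule norm_transform_le[OF partition_times[OF l] _ _ _ e])
    show "adapted_on l D"
      unfolding adapted_on_def
    proof
      fix v assume v: "v \<in> set l"
      then have "0 \<le> v" using u[OF v] by simp
      then show "D v \<in> At v" unfolding D_def
        using u[OF v] by (intro filtration_closed X_adapted) auto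
    qed
    fix v assume v: "v \<in> set l"
    show "norm (X v) \<le> C" using partition_range[OF l v] by (rule C)
    have b: "X (?r v) \<in> bounded_ops" "X (?s v) \<in> bounded_ops"
      using u[OF v] by (auto intro: bounded X_closed)
    have D: "D v = adj (X (?r v) - X (?s v))" by (simp add: D_def adj_diff b)
    have "norm (D v) \<le> norm (adj (X (?r v))) + norm (adj (X (?s v)))"
      unfolding D_def by (rule norm_triangle_ineq4)
    also have "\<dots> \<le> 2 * C" using C[of "?r v"] C[of "?s v"] u[OF v] by (simp add: norm_adj b)
    finally show "norm (D v) \<le> 2 * C" .
    have eA: "e \<in> bounded_ops" "adj e = e" using e bounded by (auto simp: projections_def)
    have db: "X (?r v) - X (?s v) \<in> bounded_ops"
      using u[OF v] by (intro bounded increment_closed)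
    have "D v o\<^sub>L e = adj (e o\<^sub>L (X (?r v) - X (?s v)))"
      by (simp only: D adj_compose eA db)
    then have "norm (D v o\<^sub>L e) = norm (e o\<^sub>L (X (?r v) - X (?s v)))"
      by (simp only: norm_adj bounded_ops_compose eA db)
    also have "\<dots> \<le> \<eta>" using u[OF v] by (intro small) auto
    finally show "norm (D v o\<^sub>L e) \<le> \<eta>" .
  qed
  moreover have "14 * (2 * C)\<^sup>2 * C\<^sup>2 = 56 * (C\<^sup>2)\<^sup>2" by (simp add: power2_eq_square)
  ultimately show ?thesis by (simp only:)
qed

lemma right_sum_Cauchy:
  assumes segal: "segal_left A \<tau> X 0 t" and \<kappa>: "\<kappa> > 0"
  shows "\<exists>\<delta>>0. \<forall>\<theta>\<in>partitions t. \<forall>\<theta>'\<in>partitions t. mesh \<theta> < \<delta> \<longrightarrow> mesh \<theta>' < \<delta> \<longrightarrow>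
    norm (\<iota> (right_sum (\<lambda>u. adj (X u)) X \<theta>) - \<iota> (right_sum (\<lambda>u. adj (X u)) X \<theta>')) < \<kappa>"
proof -
  define C where "C = norm (X t)"
  \<comment> \<open>\<eta> and \<epsilon> make each of the two error terms smaller than half of the
    square of \<kappa>; the added 1 keeps the denominators positive when C = 0.\<close>
  define \<eta> where "\<eta> = sqrt (\<kappa>\<^sup>2 / (16 * (C\<^sup>2 + 1)))"
  define \<epsilon> where "\<epsilon> = (\<kappa>\<^sup>2 / (2 * (56 * (C\<^sup>2)\<^sup>2 + 1)))\<^sup>2"
  have C1: "C\<^sup>2 + 1 > 0" "56 * (C\<^sup>2)\<^sup>2 + 1 > 0" by (simp_all add: add_nonneg_pos)
  have \<eta>: "\<eta> > 0" and \<epsilon>: "\<epsilon> > 0" using \<kappa> C1 by (simp_all add: \<eta>_def \<epsilon>_def)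
  have "8 * \<eta>\<^sup>2 * C\<^sup>2 < \<kappa>\<^sup>2 / 2"
    using \<kappa> C1(1) by (simp add: \<eta>_def field_simps)
  moreover have "sqrt \<epsilon> = \<kappa>\<^sup>2 / (2 * (56 * (C\<^sup>2)\<^sup>2 + 1))"
    unfolding \<epsilon>_def by (rule real_sqrt_unique) simp_all
  then have "56 * (C\<^sup>2)\<^sup>2 * sqrt \<epsilon> + sqrt \<epsilon> = \<kappa>\<^sup>2 / 2"
    using C1(2) by (simp add: eq_divide_eq algebra_simps)
  then have "56 * (C\<^sup>2)\<^sup>2 * sqrt \<epsilon> < \<kappa>\<^sup>2 / 2"
    using real_sqrt_gt_zero[OF \<epsilon>] by linarith
  ultimately have small: "8 * \<eta>\<^sup>2 * C\<^sup>2 + 56 * (C\<^sup>2)\<^sup>2 * sqrt \<epsilon> < \<kappa>\<^sup>2" by simp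
  obtain e where e: "e \<in> projections A" "Re (\<tau> e) > 1 - \<epsilon>" and "\<forall>\<eta>>0. \<exists>\<delta>>0. \<forall>s\<in>{0..t}. \<forall>r\<in>{0..t}.
      \<bar>r - s\<bar> < \<delta> \<longrightarrow> e o\<^sub>L (X r - X s) \<in> A \<and> norm (e o\<^sub>L (X r - X s)) \<le> \<eta>"
    using segal[unfolded segal_left_def, rule_format, OF \<epsilon>] by blast
  from this(3)[rule_format, OF \<eta>]
  obtain \<delta> where \<delta>: "\<delta> > 0" "\<And>r s. r \<in> {0..t} \<Longrightarrow> s \<in> {0..t} \<Longrightarrow> \<bar>r - s\<bar> < \<delta> \<Longrightarrow>
      norm (e o\<^sub>L (X r - X s)) \<le> \<eta>"
    by blast
  have "norm (\<iota> (right_sum (\<lambda>u. adj (X u)) X \<theta>) - \<iota> (right_sum (\<lambda>u. adj (X u)) X \<theta>')) < \<kappa>"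
    if "\<theta> \<in> partitions t" "\<theta>' \<in> partitions t" "mesh \<theta> < \<delta>" "mesh \<theta>' < \<delta>" for \<theta> \<theta>'
    using norm_right_sum_diff_le[OF that(1,2) e(1) less_imp_le[OF e(2)] \<delta>(2) that(3,4)] small \<kappa>
    unfolding C_def[symmetric] by (smt (verit) power_mono)
  then show ?thesis using \<delta>(1) by blast
qed

lemma left_sum_eq_adj_right_sum:
  assumes "times l"
  shows "left_sum (\<lambda>u. adj (X u)) X l = adj (right_sum (\<lambda>u. adj (X u)) X l)"
proof -
  have "times l \<Longrightarrow> pair_sum (\<lambda>a b. (adj (X b) - adj (X a)) o\<^sub>L X a) l =
      adj (pair_sum (\<lambda>a b. adj (X a) o\<^sub>L (X b - X a)) l)"
  proof (induction "\<lambda>a b. adj (X a) o\<^sub>L (X b - X a)" l rule: pair_sum.induct)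
    case (1 a b l)
    then have t: "times (b # l)" and a: "0 \<le> a" "0 \<le> b" by (auto simp: times_def)
    have m: "X a \<in> A" "X b \<in> A" "X b - X a \<in> A" using a by (simp_all add: X_closed closed)
    have "pair_sum (\<lambda>a b. adj (X a) o\<^sub>L (X b - X a)) (b # l) \<in> A"
      by (rule pair_sum_closed[OF t]) (use t in \<open>auto simp: times_def intro!: closed X_closed\<close>)
    then show ?case using 1(1)[OF t] m
      by (simp add: adj_add bounded closed adj_compose adj_adj adj_diff)
  next
    case "2_1" show ?case using adj_diff[OF bounded bounded, of 0 0] closed by simp
  next
    case ("2_2" a) show ?case using adj_diff[OF bounded bounded, of 0 0] closed by simp
  qed
  then show ?thesis using assms by (simp add: left_sum_eq_pair_sum right_sum_eq_pair_sum)
qed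

lemma left_sum_closed:
  assumes "\<theta> \<in> partitions t"
  shows "left_sum (\<lambda>u. adj (X u)) X \<theta> \<in> A"
  using right_sum_closed[OF assms] partition_times[OF assms]
  by (simp add: left_sum_eq_adj_right_sum closed)

text \<open>The adjoint is an isometry for the trace norm, so the Cauchy property passes from right
  sums to left sums.\<close>

lemma norm_left_sum_diff:
  assumes "\<theta> \<in> partitions t" "\<theta>' \<in> partitions t"
  shows "norm (\<iota> (left_sum (\<lambda>u. adj (X u)) X \<theta>) - \<iota> (left_sum (\<lambda>u. adj (X u)) X \<theta>')) =
    norm (\<iota> (right_sum (\<lambda>u. adj (X u)) X \<theta>) - \<iota> (right_sum (\<lambda>u. adj (X u)) X \<theta>'))"
proof -
  let ?R = "right_sum (\<lambda>u. adj (X u)) X"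
  note m = right_sum_closed[OF assms(1)] right_sum_closed[OF assms(2)]
  have "norm (\<iota> (adj (?R \<theta>)) - \<iota> (adj (?R \<theta>'))) = norm (\<iota> (adj (?R \<theta> - ?R \<theta>')))"
    using m by (simp add: adj_diff bounded embed_diff closed)
  also have "\<dots> = norm (\<iota> (?R \<theta>) - \<iota> (?R \<theta>'))"
    using m by (simp add: norm_embed_adj closed embed_diff)
  finally show ?thesis
    by (simp add: left_sum_eq_adj_right_sum partition_times[OF assms(1)] partition_times[OF assms(2)])
qed

lemma quad_sum_eq:
  assumes "\<theta> \<in> partitions t"
  shows "quad_sum X \<theta> = abs_sq (X t) - abs_sq (X 0) -
    (left_sum (\<lambda>u. adj (X u)) X \<theta> + right_sum (\<lambda>u. adj (X u)) X \<theta>)"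
proof -
  have "abs_sq (X b - X a) = (abs_sq (X b) - abs_sq (X a)) -
      (((adj (X b) - adj (X a)) o\<^sub>L X a) + (adj (X a) o\<^sub>L (X b - X a)))"
    if "a \<in> set \<theta>" "b \<in> set \<theta>" for a b
    using that partition_range(1)[OF assms]
    by (simp add: abs_sq_def adj_diff bounded X_closed compose_distrib)
  then have "quad_sum X \<theta> = pair_sum (\<lambda>a b. (abs_sq (X b) - abs_sq (X a)) -
      (((adj (X b) - adj (X a)) o\<^sub>L X a) + (adj (X a) o\<^sub>L (X b - X a)))) \<theta>"
    unfolding quad_sum_eq_pair_sum by (intro pair_sum_cong)
  also have "\<dots> = pair_sum (\<lambda>a b. abs_sq (X b) - abs_sq (X a)) \<theta> -
      (left_sum (\<lambda>u. adj (X u)) X \<theta> + right_sum (\<lambda>u. adj (X u)) X \<theta>)"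
    by (simp only: left_sum_eq_pair_sum right_sum_eq_pair_sum pair_sum_add[symmetric] pair_sum_diff[symmetric])
  also have "pair_sum (\<lambda>a b. abs_sq (X b) - abs_sq (X a)) \<theta> = abs_sq (X t) - abs_sq (X 0)"
    using assms pair_sum_telescope[of \<theta> "\<lambda>u. abs_sq (X u)"] by (simp add: partitions_iff)
  finally show ?thesis .
qed

lemma quad_sum_tendsto:
  assumes segal: "segal_left A \<tau> X 0 t" and t: "0 \<le> t"
  shows "((\<lambda>\<theta>. \<iota> (quad_sum X \<theta>)) \<longlongrightarrow> quad_variation \<iota> X t) (mesh_to_0 t)"
proof -
  have "((\<lambda>\<theta>. \<iota> (right_sum (\<lambda>u. adj (X u)) X \<theta>)) \<longlongrightarrow> right_integral \<iota> (\<lambda>u. adj (X u)) X t) (mesh_to_0 t)"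
    unfolding right_integral_def
    using right_sum_Cauchy[OF segal] by (intro convergent_if_Cauchy_mesh[OF t])
  moreover have "((\<lambda>\<theta>. \<iota> (left_sum (\<lambda>u. adj (X u)) X \<theta>)) \<longlongrightarrow> left_integral \<iota> (\<lambda>u. adj (X u)) X t) (mesh_to_0 t)"
    unfolding left_integral_def
    using right_sum_Cauchy[OF segal] by (intro convergent_if_Cauchy_mesh[OF t]) (simp add: norm_left_sum_diff)
  ultimately have "((\<lambda>\<theta>. \<iota> (abs_sq (X t)) - \<iota> (abs_sq (X 0)) -
      (\<iota> (left_sum (\<lambda>u. adj (X u)) X \<theta>) + \<iota> (right_sum (\<lambda>u. adj (X u)) X \<theta>)))
      \<longlongrightarrow> quad_variation \<iota> X t) (mesh_to_0 t)"
    unfolding quad_variation_def by (intro tendsto_intros)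
  moreover have "\<forall>\<^sub>F \<theta> in mesh_to_0 t. \<iota> (quad_sum X \<theta>) = \<iota> (abs_sq (X t)) - \<iota> (abs_sq (X 0)) -
      (\<iota> (left_sum (\<lambda>u. adj (X u)) X \<theta>) + \<iota> (right_sum (\<lambda>u. adj (X u)) X \<theta>))"
    unfolding eventually_mesh_to_0
    \<comment> \<open>The identity holds for every partition, so the mesh threshold 1 is
      arbitrary.\<close>
    using t by (intro exI[of _ 1])
      (simp add: quad_sum_eq embed_diff embed_add closed abs_sq_closed X_closed left_sum_closed right_sum_closed)
  ultimately show ?thesis by (simp add: tendsto_cong)
qed

end

theorem theorem6:
  fixes A :: "'h::complex_hilbert_space op set"
    and \<tau> :: "'h op \<Rightarrow> complex"
    and At :: "real \<Rightarrow> 'h op set"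
    and E :: "real \<Rightarrow> 'h op \<Rightarrow> 'h op"
    and \<iota> :: "'h op \<Rightarrow> 'k::complex_hilbert_space"
    and X :: "real \<Rightarrow> 'h op"
    and t :: real
  assumes "von_neumann_algebra A"
    and "normal_faithful_unital_trace A \<tau>"
    and "filtration A At"
    and "\<And>s. s \<ge> 0 \<Longrightarrow> normal_conditional_expectation A (At s) (E s)"
    and "\<And>s T. s \<ge> 0 \<Longrightarrow> T \<in> A \<Longrightarrow> \<tau> (E s T) = \<tau> T"
    and "is_L2_space A \<tau> \<iota>"
    and "martingale A E X"
    and "segal_continuous A \<tau> X"
    and "t \<ge> 0"
  shows "((\<lambda>\<theta>. \<iota> (quad_sum X \<theta>)) \<longlongrightarrow> quad_variation \<iota> X t) (mesh_to_0 t)"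
proof -
  interpret martingale_L2 A \<tau> \<iota> At E X
    by unfold_locales (fact assms)+
  show ?thesis
    using assms(8,9) by (intro quad_sum_tendsto) (simp_all add: segal_continuous_def)
qed

end
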